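(* Let $\varepsilon>\frac{5}{6}$. If $A\subseteq\{0,1\}^*$ is $\varepsilon'^{11}$-rich for some $\varepsilon'<\varepsilon$, then $H=\Omega_3(A)$ is an $\varepsilon$-hitting set for the class of read-once branching programs of width $3$.
   Context: A branching program $P$ on Boolean variables $x_1,\ldots,x_n$ is a directed acyclic multigraph with one source; every non-sink node has out-degree 2, is labeled by a variable $x_i$, and its two outgoing edges are labeled $0$ and $1$; sinks are labeled $0$ or $1$. On input $\mathbf{a}\in\{0,1\}^n$ the computation starts at the source and at a node labeled $x_i$ follows the edge labeled $a_i$ until a sink is reached; the sink's label is $P(\mathbf{a})$. $P$ is read-once if every variable is queried at most once along each computational path. Programs are leveled: the nodes are partitioned into levels, the source forms level $0$, edges go only from level $k$ to level $k+1$, and the last level consists of all sinks; the width is the maximum number of nodes on a level. A set $H\subseteq\{0,1\}^*$ is an $\varepsilon$-hitting set for a class $\mathcal P$ if for all sufficiently large $n$, for every $P\in\mathcal P$ on $n$ variables, $|P^{-1}(1)|/2^n\geq\varepsilon$ implies there is $\mathbf{a}\in H\cap\{0,1\}^n$ with $P(\mathbf{a})=1$. For $\eta>0$, a set $A\subseteq\{0,1\}^*$ is $\eta$-rich if for all sufficiently large $n$, for every index set $I\subseteq\{1,\ldots,n\}$, every partition $\{R_1,\ldots,R_r\}$ of $I$ ($r\geq0$) with $\prod_{j=1}^r(1-2^{-|R_j|})\geq\eta$, every $Q\subseteq\{1,\ldots,n\}\setminus I$ with $|Q|\leq\log_2 n$, and every $\mathbf{c}\in\{0,1\}^n$, there exists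 $\mathbf{a}\in A\cap\{0,1\}^n$ with $a_i=c_i$ for all $i\in Q$ and, for every $j\in\{1,\ldots,r\}$, some $i\in R_j$ with $a_i\neq c_i$. For $\mathbf{a}\in\{0,1\}^n$, $\Omega_c(\mathbf{a})=\{\mathbf{a}'\in\{0,1\}^n: h(\mathbf{a},\mathbf{a}')\leq c\}$ where $h$ is Hamming distance, and $\Omega_c(A)=\bigcup_{\mathbf{a}\in A}\Omega_c(\mathbf{a})$. *)

theory Defs
  imports Complex_Main "HOL-Library.Disjoint_Sets"
begin

text \<open>
  A word \<open>a \<in> {0,1}\<^sup>n\<close> is a Boolean list of length \<open>n\<close>. Positions, and hence variable indices,
  are counted from 0: the variable \<open>x\<^sub>i\<^sub>+\<^sub>1\<close> has index \<open>i\<close> and value \<open>a ! i\<close>.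
\<close>

definition cube :: "nat \<Rightarrow> bool list set" where
  "cube n = {a. length a = n}"

definition hamming :: "bool list \<Rightarrow> bool list \<Rightarrow> nat" where
  "hamming a a' = card {i. i < length a \<and> a ! i \<noteq> a' ! i}"

definition Omega :: "nat \<Rightarrow> bool list \<Rightarrow> bool list set" where
  "Omega c a = {a' \<in> cube (length a). hamming a a' \<le> c}"

definition Omega_set :: "nat \<Rightarrow> bool list set \<Rightarrow> bool list set" where
  "Omega_set c A = (\<Union>a\<in>A. Omega c a)"

text \<open>
  Every non-sink node \<open>v\<close> has exactly two outgoing edges: the edge labeled \<open>b\<close> leads to
  \<open>succ P v b\<close>. The two may end in the same node, so this describes a multigraph.
  The values of \<open>var\<close> and \<open>succ\<close> at sinks, and those of \<open>label\<close> at other nodes, are irrelevant.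
\<close>

record 'v bprog =
  nvars :: nat
  nodes :: "'v set"
  source :: 'v
  sinks :: "'v set"
  var :: "'v \<Rightarrow> nat"
  succ :: "'v \<Rightarrow> bool \<Rightarrow> 'v"
  label :: "'v \<Rightarrow> bool"
  level :: "'v \<Rightarrow> nat"
  depth :: nat

text \<open>Acyclicity is a consequence of \<open>level_succ\<close>.\<close>

locale branching_program =
  fixes P :: "'v bprog"
  assumes finite_nodes: "finite (nodes P)"
    and source_in_nodes: "source P \<in> nodes P"
    and sinks_subset: "sinks P \<subseteq> nodes P"
    and var_less: "\<And>v. v \<in> nodes P - sinks P \<Longrightarrow> var P v < nvars P"
    and succ_in_nodes: "\<And>v b. v \<in> nodes P - sinks P \<Longrightarrow> succ P v b \<in> nodes P"
    and one_source: "{v \<in> nodes P. \<forall>u \<in> nodes P - sinks P. \<forall>b. succ P u b \<noteq> v} = {source P}"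
    and level_le: "\<And>v. v \<in> nodes P \<Longrightarrow> level P v \<le> depth P"
    and level_succ: "\<And>v b. v \<in> nodes P - sinks P \<Longrightarrow> level P (succ P v b) = Suc (level P v)"
    and first_level: "{v \<in> nodes P. level P v = 0} = {source P}"
    and last_level: "{v \<in> nodes P. level P v = depth P} = sinks P"

definition width :: "'v bprog \<Rightarrow> nat" where
  "width P = Max ((\<lambda>k. card {v \<in> nodes P. level P v = k}) ` {..depth P})"

text \<open>
  \<open>node_at P a k\<close> is the node reached on input \<open>a\<close> after \<open>k\<close> steps. It is meaningful only up to the
  first sink, which is reached after \<open>steps P a\<close> steps.
\<close>

primrec node_at :: "'v bprog \<Rightarrow> bool list \<Rightarrow> nat \<Rightarrow> 'v" where
  "node_at P a 0 = source P"
| "node_at P a (Suc k) = succ P (node_at P a k) (a ! var P (node_at P a k))"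

definition steps :: "'v bprog \<Rightarrow> bool list \<Rightarrow> nat" where
  "steps P a = (LEAST k. node_at P a k \<in> sinks P)"

definition eval_bp :: "'v bprog \<Rightarrow> bool list \<Rightarrow> bool" where
  "eval_bp P a = label P (node_at P a (steps P a))"

definition read_once :: "'v bprog \<Rightarrow> bool" where
  "read_once P \<longleftrightarrow>
     (\<forall>a \<in> cube (nvars P). inj_on (\<lambda>k. var P (node_at P a k)) {..<steps P a})"

definition robp :: "nat \<Rightarrow> 'v bprog set" where
  "robp w = {P. branching_program P \<and> read_once P \<and> width P = w}"

context branching_program
begin

lemma sinks_iff: "v \<in> sinks P \<longleftrightarrow> v \<in> nodes P \<and> level P v = depth P"
  using last_level by blast

lemma node_at_level:
  "k \<le> depth P \<Longrightarrow> node_at P a k \<in> nodes P \<and> level P (node_at P a k) = k"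
proof (induction k)
  case 0
  then show ?case using first_level by auto
next
  case (Suc k)
  then have k: "node_at P a k \<in> nodes P" "level P (node_at P a k) = k" by auto
  with Suc.prems have "node_at P a k \<in> nodes P - sinks P" by (simp add: sinks_iff)
  then show ?case using k succ_in_nodes level_succ by simp
qed

lemma steps_eq_depth: "steps P a = depth P"
  unfolding steps_def
proof (rule Least_equality)
  show "node_at P a (depth P) \<in> sinks P"
    using node_at_level[of "depth P" a] by (simp add: sinks_iff)
  show "depth P \<le> k" if "node_at P a k \<in> sinks P" for k
    using that node_at_level[of k a] by (cases "k \<le> depth P") (auto simp: sinks_iff)
qed

end

definition hitting_set :: "real \<Rightarrow> 'v bprog set \<Rightarrow> bool list set \<Rightarrow> bool" where
  "hitting_set \<epsilon> \<P> H \<longleftrightarrow>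
     (\<forall>\<^sub>F n in sequentially. \<forall>P \<in> \<P>. nvars P = n \<longrightarrow>
        card {a \<in> cube n. eval_bp P a} / 2 ^ n \<ge> \<epsilon> \<longrightarrow> (\<exists>a \<in> H \<inter> cube n. eval_bp P a))"

text \<open>Richness is a notion for positive \<open>\<eta>\<close> only, so positivity is part of the definition.\<close>

definition rich :: "real \<Rightarrow> bool list set \<Rightarrow> bool" where
  "rich \<eta> A \<longleftrightarrow> \<eta> > 0 \<and>
     (\<forall>\<^sub>F n in sequentially. \<forall>I \<R> Q. \<forall>c \<in> cube n.
        I \<subseteq> {..<n} \<longrightarrow> partition_on I \<R> \<longrightarrow> (\<Prod>R\<in>\<R>. 1 - 1 / 2 ^ card R) \<ge> \<eta> \<longrightarrow>
        Q \<subseteq> {..<n} - I \<longrightarrow> card Q \<le> log 2 n \<longrightarrow>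
        (\<exists>a \<in> A \<inter> cube n. (\<forall>i\<in>Q. a ! i = c ! i) \<and> (\<forall>R\<in>\<R>. \<exists>i\<in>R. a ! i \<noteq> c ! i)))"

end

(*
  Fix a target set T on level L and call a node good if it reaches T, bad otherwise; let j be the
  first level with a bad node. All nodes of level j - 1 are good, so one changed bit brings every
  input to a good node of level j, and from level j on there are at most two good nodes per level.
  There the program acts like a read-once CNF: as more than 5/6 of the mass reaches T, only the
  lighter good node can leak mass to bad nodes. Every such leak is avoided by one clause (the
  queries that made the node light), and a clause R costs a factor 1 - 2^-(|R|+3) of the mass.

  Suppose level j has two good nodes. Following the lighter one, either at most log n literals Q
  force it to a level where one more changed bit merges it with the heavier one; then Q and the
  clauses form the test to which richness applies. Or more than log n leaks come first; then less
  than 1/n of the mass is lost by taking the heavier node of level j as the new target. The second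
  case uses up more than log n levels, so it occurs at most n / log n times.
*)
theory Submission
  imports Defs
begin

section \<open>Read-once programs and the mass of a node\<close>

text \<open>Richness needs disjoint sets of variables, but read-onceness forbids repetition only
  along a path: nodes on different paths may query the same variable. This shapes the construction.
  A literal is a node with an answer, and literals are collected only at nodes from which the nodes
  of all later literals can be reached. Then \<open>var_neq\<close> makes the variables distinct,
  and it also shows that a bit changed at a node cannot disturb literals below that node.

  The constants come from three accounts. A node holding half of a total mass of at most 1 cannot
  leak, since at most 3/4 would be left. A light node starts from a node with at least a quarter of
  the mass, is halved by every pending literal, and loses another half of itself in a leak; this
  gives \<open>2 ^ (card R + 3)\<close>. The power 11 turns the factor
  \<open>1 - 1 / 2 ^ (m + 3)\<close> of the mass into the factor \<open>1 - 1 / 2 ^ m\<close> of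
  richness.

  Losing 1 / n in each of n / log n rounds costs 1 / log n in total, which tends to 0 and fits into
  any gap below \<epsilon>.\<close>

locale read_once_bp = branching_program P for P :: "'v bprog" +
  assumes ro: "read_once P"
begin

definition edge :: "'v \<Rightarrow> 'v \<Rightarrow> bool" where
  "edge u v \<longleftrightarrow> u \<in> nodes P - sinks P \<and> (\<exists>b. v = succ P u b)"

lemma edge_nodes: "edge u v \<Longrightarrow> u \<in> nodes P \<and> u \<notin> sinks P \<and> v \<in> nodes P"
  using succ_in_nodes by (auto simp: edge_def)

lemma edge_level: "edge u v \<Longrightarrow> level P v = Suc (level P u)"
  using level_succ by (auto simp: edge_def)

lemma reach_level: "edge\<^sup>*\<^sup>* u v \<Longrightarrow> level P u \<le> level P v"
  by (induction rule: rtranclp_induct) (auto dest: edge_level)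

lemma reach_same_level: "edge\<^sup>*\<^sup>* u v \<Longrightarrow> level P u = level P v \<Longrightarrow> u = v"
  by (metis edge_level converse_rtranclpE reach_level Suc_n_not_le_n)

lemma nonsink_iff: "v \<in> nodes P \<Longrightarrow> v \<notin> sinks P \<longleftrightarrow> level P v < depth P"
  by (auto simp: sinks_iff le_less dest: level_le)

lemma node_at_nonsink: "k < depth P \<Longrightarrow> node_at P a k \<in> nodes P - sinks P"
  using node_at_level[of k a] nonsink_iff by auto

lemma node_at_edge: "k < depth P \<Longrightarrow> edge (node_at P a k) (node_at P a (Suc k))"
  using node_at_nonsink by (auto simp: edge_def)

lemma node_at_reach: "i \<le> k \<Longrightarrow> k \<le> depth P \<Longrightarrow> edge\<^sup>*\<^sup>* (node_at P a i) (node_at P a k)"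
proof (induction k rule: dec_induct)
  case (step m)
  then show ?case using node_at_edge[of m a] by (simp del: node_at.simps)
qed auto

lemma inj_vars: "a \<in> cube (nvars P) \<Longrightarrow> inj_on (\<lambda>k. var P (node_at P a k)) {..<depth P}"
  using ro steps_eq_depth by (auto simp: read_once_def)

text \<open>An input reads \<open>depth P\<close> different variables. This bounds the number of
  levels, and with it the total loss of mass, in terms of \<open>nvars P\<close>.\<close>

lemma depth_le_nvars: "depth P \<le> nvars P"
proof -
  define a where "a = replicate (nvars P) False"
  have "a \<in> cube (nvars P)" by (simp add: a_def cube_def)
  from inj_vars[OF this] have "card {..<depth P} \<le> card {..<nvars P}"
    by (rule card_inj_on_le) (use var_less node_at_nonsink in auto)
  then show ?thesis by simp
qed

text \<open>By read-onceness no earlier step reads the variable queried at step \<open>j\<close>, so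
  overwriting it cannot divert the path before that step.\<close>

lemma node_at_update:
  assumes a: "a \<in> cube (nvars P)" and j: "j < depth P" and i: "i \<le> j"
  shows "node_at P (a[var P (node_at P a j) := b]) i = node_at P a i"
  using i
proof (induction i)
  case (Suc i)
  then have "var P (node_at P a i) \<noteq> var P (node_at P a j)"
    using inj_vars[OF a] j by (auto dest: inj_onD[of _ _ i j])
  with Suc show ?case by simp
qed auto

lemma node_at_update_Suc:
  assumes a: "a \<in> cube (nvars P)" and j: "j < depth P"
  shows "node_at P (a[var P (node_at P a j) := b]) (Suc j) = succ P (node_at P a j) b"
  using node_at_update[OF assms order_refl, of b] a var_less[OF node_at_nonsink[OF j, of a]]
  by (simp add: cube_def)

text \<open>Edge by edge, the variable queried at the tail is overwritten, and read-onceness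
  protects the steps already fixed. So every path of the graph is followed by some input.\<close>

lemma extend_path:
  assumes "edge\<^sup>*\<^sup>* u v" "a \<in> cube (nvars P)" "node_at P a (level P u) = u" "v \<in> nodes P"
  shows "\<exists>a' \<in> cube (nvars P). node_at P a' (level P u) = u \<and> node_at P a' (level P v) = v"
  using assms
proof (induction rule: rtranclp_induct)
  case (step y z)
  have y: "y \<in> nodes P" "y \<notin> sinks P" using edge_nodes step by auto
  with step obtain a' where a': "a' \<in> cube (nvars P)" "node_at P a' (level P u) = u"
    "node_at P a' (level P y) = y" by auto
  obtain b where b: "z = succ P y b" using step by (auto simp: edge_def)
  have d: "level P y < depth P" using y nonsink_iff by auto
  let ?a = "a'[var P y := b]"
  have "node_at P ?a (Suc (level P y)) = z"
    using node_at_update_Suc[OF a'(1) d, of b] a' b by (simp del: node_at.simps)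
  moreover have "node_at P ?a (level P u) = u"
    using node_at_update[OF a'(1) d, of "level P u" b] a' reach_level[OF step(1)] by simp
  ultimately show ?case using a'(1) edge_level[OF step(2)]
    by (intro bexI[of _ ?a]) (auto simp: cube_def simp del: node_at.simps)
qed auto

lemma level_source: "level P (source P) = 0"
  using first_level by blast

lemma reach_from_source:
  assumes "v \<in> nodes P" shows "edge\<^sup>*\<^sup>* (source P) v"
  using assms
proof (induction "level P v" arbitrary: v)
  case 0
  then have "v = source P" using first_level by auto
  then show ?case by simp
next
  case (Suc k)
  have "v \<noteq> source P" using Suc.hyps(2) level_source by auto
  then obtain u b where u: "u \<in> nodes P - sinks P" "succ P u b = v"
    using one_source Suc.prems by blast
  then have e: "edge u v" by (auto simp: edge_def)
  then have "edge\<^sup>*\<^sup>* (source P) u" using Suc.hyps u(1) edge_level[OF e] by auto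
  with e show ?case by simp
qed

lemma reach_input:
  assumes "v \<in> nodes P" shows "\<exists>a \<in> cube (nvars P). node_at P a (level P v) = v"
proof -
  have "replicate (nvars P) False \<in> cube (nvars P)" by (simp add: cube_def)
  from extend_path[OF reach_from_source[OF assms] this _ assms] level_source
  show ?thesis by auto
qed

text \<open>\<open>read_once\<close> speaks of inputs. Since every node is reached from the source
  and every path is followed by an input, it becomes a property of the graph alone.\<close>

lemma var_neq:
  assumes "edge\<^sup>+\<^sup>+ u v" "v \<in> nodes P - sinks P" shows "var P u \<noteq> var P v"
proof -
  from tranclpD[OF assms(1)] obtain w where w: "edge u w" "edge\<^sup>*\<^sup>* w v" by blast
  have r: "edge\<^sup>*\<^sup>* u v" using w by (rule converse_rtranclp_into_rtranclp)
  have u: "u \<in> nodes P" using edge_nodes[OF w(1)] by blast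
  have lt: "level P u < level P v" using edge_level[OF w(1)] reach_level[OF w(2)] by simp
  obtain a where a: "a \<in> cube (nvars P)" "node_at P a (level P u) = u"
    using reach_input[OF u] by blast
  obtain a' where a': "a' \<in> cube (nvars P)" "node_at P a' (level P u) = u" "node_at P a' (level P v) = v"
    using extend_path[OF r a] assms(2) by blast
  have d: "level P v < depth P" using assms(2) nonsink_iff[of v] by blast
  show ?thesis
  proof
    assume "var P u = var P v"
    then have "level P u = level P v"
      using inj_onD[OF inj_vars[OF a'(1)], of "level P u" "level P v"] a' d lt by simp
    with lt show False by simp
  qed
qed

section \<open>The mass of a node as the distribution of a random walk\<close>

definition push :: "('v \<Rightarrow> real) \<Rightarrow> 'v \<Rightarrow> real" where
  "push f v = (\<Sum>u \<in> nodes P - sinks P. (of_bool (succ P u False = v) + of_bool (succ P u True = v)) * f u / 2)"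

text \<open>Iterating a linear operator instead of counting inputs lets the estimates about
  \<open>push\<close> serve also for the part of the mass that passes through one chosen node. The
  count is recovered in \<open>mass_eq\<close>.\<close>

definition mass :: "nat \<Rightarrow> 'v \<Rightarrow> real" where
  "mass k = (push ^^ k) (\<lambda>v. of_bool (v = source P))"

lemma mass_Suc: "mass (Suc k) = push (mass k)"
  by (simp add: mass_def)

lemma finite_cube: "finite (cube n)"
  using finite_lists_length_eq[of "UNIV :: bool set" n] by (simp add: cube_def)

lemma card_cube: "card (cube n) = 2 ^ n"
  using card_lists_length_eq[of "UNIV :: bool set" n] by (simp add: cube_def)

text \<open>Flipping the bit queried at \<open>u\<close> keeps the path up to \<open>u\<close>, so
  it pairs the inputs that answer \<open>b\<close> there with those that answer
  \<open>\<not> b\<close>.\<close>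

lemma card_bit:
  assumes k: "k < depth P" and u: "u \<in> nodes P - sinks P"
  shows "2 * card {a \<in> cube (nvars P). node_at P a k = u \<and> a ! var P u = b}
       = card {a \<in> cube (nvars P). node_at P a k = u}" (is "2 * card (?A b) = card ?B")
proof -
  have "bij_betw (\<lambda>a. a[var P u := \<not> b]) (?A b) (?A (\<not> b))" for b
  proof (rule bij_betwI[where g = "\<lambda>a. a[var P u := b]"])
    show "(\<lambda>a. a[var P u := \<not> b]) \<in> ?A b \<rightarrow> ?A (\<not> b)"
      using node_at_update[OF _ k order_refl] var_less[OF u] by (auto simp: cube_def)
    show "(\<lambda>a. a[var P u := b]) \<in> ?A (\<not> b) \<rightarrow> ?A b"
      using node_at_update[OF _ k order_refl] var_less[OF u] by (auto simp: cube_def)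
    show "a[var P u := \<not> b, var P u := b] = a" if "a \<in> ?A b" for a
      using that var_less[OF u] by (simp add: cube_def list_update_same_conv)
    show "a[var P u := b, var P u := \<not> b] = a" if "a \<in> ?A (\<not> b)" for a
      using that var_less[OF u] by (simp add: cube_def list_update_same_conv)
  qed
  from bij_betw_same_card[OF this[of b]] have "card (?A b) = card (?A (\<not> b))" .
  moreover have "card ?B = card (?A b) + card (?A (\<not> b))"
  proof (subst card_Un_disjoint[symmetric])
    show "card ?B = card (?A b \<union> ?A (\<not> b))" by (rule arg_cong[where f = card]) auto
  qed (auto simp: finite_cube)
  ultimately show ?thesis by simp
qed

lemma mass_eq:
  "k \<le> depth P \<Longrightarrow> mass k v = card {a \<in> cube (nvars P). node_at P a k = v} / 2 ^ nvars P"
proof (induction k arbitrary: v)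
  case 0
  then show ?case by (auto simp: mass_def card_cube)
next
  case (Suc k)
  let ?A = "\<lambda>u b. {a \<in> cube (nvars P). node_at P a k = u \<and> a ! var P u = b}"
  let ?N = "nodes P - sinks P"
  let ?E = "Sigma ?N (\<lambda>u. {b. succ P u b = v})"
  have k: "k < depth P" using Suc.prems by simp
  have "{a \<in> cube (nvars P). node_at P a (Suc k) = v} = (\<Union>(u, b) \<in> ?E. ?A u b)"
    using node_at_nonsink[OF k] by auto
  then have "card {a \<in> cube (nvars P). node_at P a (Suc k) = v} = (\<Sum>(u, b) \<in> ?E. card (?A u b))"
    using finite_nodes by (simp only: case_prod_unfold) (rule card_UN_disjoint; auto simp: finite_cube)
  also have "\<dots> = (\<Sum>u \<in> ?N. \<Sum>b \<in> {b. succ P u b = v}. card (?A u b))"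
    using finite_nodes by (subst sum.Sigma) auto
  finally have "real (card {a \<in> cube (nvars P). node_at P a (Suc k) = v})
      = (\<Sum>u \<in> ?N. \<Sum>b \<in> {b. succ P u b = v}. real (card (?A u b)))" by simp
  also have "\<dots> = (\<Sum>u \<in> ?N. \<Sum>b \<in> {b. succ P u b = v}. 2 ^ nvars P * mass k u / 2)"
  proof (intro sum.cong refl)
    fix u b assume "u \<in> ?N"
    from card_bit[OF k this, of b, THEN arg_cong[where f = real]] Suc.IH[of u] k
    show "real (card (?A u b)) = 2 ^ nvars P * mass k u / 2" by simp
  qed
  also have "\<dots> = (\<Sum>u \<in> ?N. 2 ^ nvars P * ((of_bool (succ P u False = v) + of_bool (succ P u True = v)) * mass k u / 2))"
  proof (intro sum.cong refl)
    fix u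
    have "{b. succ P u b = v} = (if succ P u False = v then {False} else {}) \<union> (if succ P u True = v then {True} else {})"
      by (rule set_eqI, case_tac x) auto
    then show "(\<Sum>b \<in> {b. succ P u b = v}. 2 ^ nvars P * mass k u / 2)
      = 2 ^ nvars P * ((of_bool (succ P u False = v) + of_bool (succ P u True = v)) * mass k u / 2)"
      by auto
  qed
  also have "\<dots> = 2 ^ nvars P * mass (Suc k) v"
    by (simp add: mass_Suc push_def sum_distrib_left)
  finally show ?case by simp
qed

lemma mass_nonneg: "0 \<le> mass k v"
proof (induction k arbitrary: v)
  case (Suc k)
  then show ?case by (auto simp: mass_Suc push_def intro!: sum_nonneg)
qed (simp add: mass_def)

lemma sum_mass:
  assumes "k \<le> depth P" "finite X"
  shows "sum (mass k) X = card {a \<in> cube (nvars P). node_at P a k \<in> X} / 2 ^ nvars P"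
proof -
  have "card {a \<in> cube (nvars P). node_at P a k \<in> X} = card (\<Union>v\<in>X. {a \<in> cube (nvars P). node_at P a k = v})"
    by (auto intro!: arg_cong[where f = card])
  also have "\<dots> = (\<Sum>v\<in>X. card {a \<in> cube (nvars P). node_at P a k = v})"
    using assms by (subst card_UN_disjoint) (auto simp: finite_cube)
  finally show ?thesis using mass_eq[OF assms(1)] by (simp add: sum_divide_distrib)
qed

lemma sum_mass_le_1:
  assumes "k \<le> depth P" "finite X" shows "sum (mass k) X \<le> 1"
proof -
  have "card {a \<in> cube (nvars P). node_at P a k \<in> X} \<le> card (cube (nvars P))"
    by (rule card_mono[OF finite_cube]) auto
  then have "real (card {a \<in> cube (nvars P). node_at P a k \<in> X}) \<le> 2 ^ nvars P"
    by (metis card_cube of_nat_le_iff of_nat_numeral of_nat_power)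
  then show ?thesis by (simp add: sum_mass[OF assms])
qed

end

section \<open>Good nodes\<close>

context read_once_bp
begin

text \<open>A clause is kept as the set of answers that it forbids in combination: only an input
  giving all of them violates it. Literals name nodes rather than variables so that reachability can
  keep them apart.\<close>

definition sat :: "bool list \<Rightarrow> ('v \<times> bool) set set \<Rightarrow> bool" where
  "sat a \<C> \<longleftrightarrow> (\<forall>C\<in>\<C>. \<exists>(u, b)\<in>C. a ! var P u \<noteq> b)"

definition agrees :: "bool list \<Rightarrow> ('v \<times> bool) set \<Rightarrow> bool" where
  "agrees a R \<longleftrightarrow> (\<forall>(u, b)\<in>R. a ! var P u = b)"

lemma sat_insert: "sat a (insert R \<C>) \<longleftrightarrow> \<not> agrees a R \<and> sat a \<C>"
  by (auto simp: sat_def agrees_def)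

lemma push_nonneg: "(\<And>u. 0 \<le> f u) \<Longrightarrow> 0 \<le> push f v"
  by (auto simp: push_def intro!: sum_nonneg)

end

locale bp_target = read_once_bp P for P :: "'v bprog" +
  fixes L :: nat and T :: "'v set"
  assumes T_nodes: "T \<subseteq> nodes P" and T_level: "\<And>t. t \<in> T \<Longrightarrow> level P t = L"
    and L_le: "L \<le> depth P"
begin

definition G :: "nat \<Rightarrow> 'v set" where
  "G i = {v \<in> nodes P. level P v = i \<and> (\<exists>t\<in>T. edge\<^sup>*\<^sup>* v t)}"

lemma finite_G [simp]: "finite (G i)"
  using finite_nodes by (simp add: G_def)

lemma G_L: "G L = T"
  using T_nodes T_level reach_same_level by (fastforce simp: G_def)

lemma G_node: "u \<in> G i \<Longrightarrow> u \<in> nodes P \<and> level P u = i"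
  by (simp add: G_def)

lemma G_nonsink: "u \<in> G i \<Longrightarrow> i < L \<Longrightarrow> u \<in> nodes P - sinks P"
  using L_le nonsink_iff[of u] by (simp add: G_def)

lemma G_edge: "u \<in> G i \<Longrightarrow> i < L \<Longrightarrow> edge u (succ P u b)"
  unfolding edge_def using G_nonsink[of u i] by blast

lemma G_pred:
  assumes "edge u x" "x \<in> G (Suc i)" shows "u \<in> G i"
  using assms edge_nodes[OF assms(1)] edge_level[OF assms(1)] unfolding G_def
  by (auto intro: converse_rtranclp_into_rtranclp)

lemma G_has_pred:
  assumes "x \<in> G (Suc i)" shows "\<exists>u\<in>G i. edge u x"
proof -
  have x: "x \<in> nodes P" "level P x = Suc i" using G_node[OF assms] by auto
  then have "x \<noteq> source P" using level_source by auto
  then obtain u b where u: "u \<in> nodes P - sinks P" "succ P u b = x"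
    using one_source x(1) by blast
  then have "edge u x" by (auto simp: edge_def)
  with G_pred[OF this assms] show ?thesis by blast
qed

lemma G_succ:
  assumes u: "u \<in> G i" and i: "i < L" shows "\<exists>b. succ P u b \<in> G (Suc i)"
proof -
  obtain t where t: "t \<in> T" "edge\<^sup>*\<^sup>* u t" using u by (auto simp: G_def)
  have "u \<noteq> t" using G_node[OF u] T_level[OF t(1)] i by auto
  with t(2) obtain y where y: "edge u y" "edge\<^sup>*\<^sup>* y t" by (metis converse_rtranclpE)
  then have "y \<in> G (Suc i)"
    using edge_nodes[OF y(1)] edge_level[OF y(1)] G_node[OF u] t(1) by (auto simp: G_def)
  with y(1) show ?thesis by (auto simp: edge_def)
qed

lemma G_nonempty: "T \<noteq> {} \<Longrightarrow> i \<le> L \<Longrightarrow> G i \<noteq> {}"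
proof (induction "L - i" arbitrary: i)
  case 0
  then have "i = L" by simp
  with 0 show ?case using G_L by simp
next
  case (Suc k)
  then have "G (Suc i) \<noteq> {}" by auto
  with G_has_pred show ?case by fastforce
qed

abbreviation into :: "'v \<Rightarrow> 'v \<Rightarrow> real" where
  "into u y \<equiv> of_bool (succ P u False = y) + of_bool (succ P u True = y)"

abbreviation keep :: "nat \<Rightarrow> 'v \<Rightarrow> real" where
  "keep i u \<equiv> of_bool (succ P u False \<in> G (Suc i)) + of_bool (succ P u True \<in> G (Suc i))"

text \<open>Good nodes have only good predecessors, so the mass on the good levels evolves without
  reference to the bad nodes.\<close>

lemma push_G:
  assumes "y \<in> G (Suc i)" "i < L" shows "push f y = (\<Sum>u\<in>G i. into u y * f u / 2)"
proof -
  have "succ P u b \<noteq> y" if "u \<in> nodes P - sinks P - G i" for u b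
    using that G_pred[of u y i] assms unfolding edge_def by blast
  moreover have "G i \<subseteq> nodes P - sinks P" using G_nonsink assms by blast
  ultimately show ?thesis unfolding push_def
    by (intro sum.mono_neutral_right) (use finite_nodes in auto)
qed

lemma sum_push_G:
  assumes "i < L" shows "sum (push f) (G (Suc i)) = (\<Sum>u\<in>G i. keep i u * f u / 2)"
proof -
  have "sum (push f) (G (Suc i)) = (\<Sum>y\<in>G (Suc i). \<Sum>u\<in>G i. into u y * f u / 2)"
    using push_G assms by (intro sum.cong) auto
  also have "\<dots> = (\<Sum>u\<in>G i. \<Sum>y\<in>G (Suc i). into u y * f u / 2)" by (rule sum.swap)
  also have "\<dots> = (\<Sum>u\<in>G i. (\<Sum>y\<in>G (Suc i). into u y) * f u / 2)"
    by (simp add: sum_divide_distrib sum_distrib_right)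
  also have "\<dots> = (\<Sum>u\<in>G i. keep i u * f u / 2)"
    by (intro sum.cong refl arg_cong[where f = "\<lambda>x. x * _ / 2"])
       (simp add: sum.distrib of_bool_def sum.delta)
  finally show ?thesis .
qed

lemma sum_push_mono:
  assumes "i < L" "\<And>u. 0 \<le> f u" shows "sum (push f) (G (Suc i)) \<le> sum f (G i)"
  unfolding sum_push_G[OF assms(1)] using assms(2) by (intro sum_mono) (auto simp: of_bool_def)

text \<open>An edge that leaves the good nodes carries half of the mass of its tail, whatever the
  other edge does.\<close>

lemma sum_push_leak:
  assumes "i < L" "\<And>u. 0 \<le> f u" "u \<in> G i" "succ P u b \<notin> G (Suc i)"
  shows "sum (push f) (G (Suc i)) \<le> sum f (G i) - f u / 2"
proof -
  have "sum (push f) (G (Suc i)) = keep i u * f u / 2 + (\<Sum>v\<in>G i - {u}. keep i v * f v / 2)"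
    unfolding sum_push_G[OF assms(1)] using assms(3) by (subst sum.remove[of _ u]) auto
  also have "\<dots> \<le> f u / 2 + (\<Sum>v\<in>G i - {u}. f v)"
    using assms(2,4) by (intro add_mono sum_mono) (cases b; auto simp: of_bool_def)+
  also have "\<dots> = sum f (G i) - f u / 2"
    using assms(3) sum.remove[of "G i" u f] by simp
  finally show ?thesis .
qed

lemma reach_later:
  assumes "\<And>y. y \<in> G i \<Longrightarrow> edge\<^sup>*\<^sup>* u y" "i \<le> j" "y \<in> G j"
  shows "edge\<^sup>*\<^sup>* u y"
  using assms(2,3)
proof (induction j arbitrary: y rule: dec_induct)
  case base
  then show ?case using assms(1) by blast
next
  case (step m)
  then show ?case using G_has_pred by (meson rtranclp.rtrancl_into_rtrancl)
qed

text \<open>Going back from a later good node through good predecessors ends in level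
  \<open>Suc i\<close>, all of which is covered by the two edges of \<open>u\<close>. By
  \<open>var_neq\<close> the variable of \<open>u\<close> is then not queried again at later good
  nodes.\<close>

lemma full_reach:
  assumes "u \<in> G i" "i < L" "G (Suc i) \<subseteq> range (succ P u)" "i < j" "y \<in> G j"
  shows "edge\<^sup>+\<^sup>+ u y"
proof -
  obtain m where m: "j = Suc m" using assms(4) by (cases j) auto
  show ?thesis
  proof (cases "m = i")
    case True
    then have "y \<in> range (succ P u)" using assms m by blast
    then show ?thesis using G_edge[OF assms(1,2)] by auto
  next
    case False
    obtain y' where y': "y' \<in> G m" "edge y' y" using G_has_pred assms m by blast
    have "edge\<^sup>*\<^sup>* u y'"
    proof (rule reach_later[OF _ _ y'(1)])
      show "Suc i \<le> m" using m False assms by simp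
      show "edge\<^sup>*\<^sup>* u z" if "z \<in> G (Suc i)" for z
      proof -
        have "z \<in> range (succ P u)" using assms(3) that by blast
        then show ?thesis using G_edge[OF assms(1,2)] by auto
      qed
    qed
    then show ?thesis using y'(2) by (rule rtranclp_into_tranclp1)
  qed
qed

end

section \<open>Avoiding leaks by clauses\<close>

text \<open>The distribution \<open>f\<close> is a parameter because it is instantiated both with
  \<open>mass\<close> and with the share of the mass that passes through \<open>x\<close>.\<close>

locale clause_run = bp_target P L T for P :: "'v bprog" and L T +
  fixes l :: nat and x :: 'v and f :: "nat \<Rightarrow> 'v \<Rightarrow> real"
  assumes l_le: "l \<le> L" and x_G: "x \<in> G l"
    and card_G: "\<And>i. l \<le> i \<Longrightarrow> i \<le> L \<Longrightarrow> card (G i) \<le> 2"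
    and f_nonneg: "\<And>i v. 0 \<le> f i v" and f_Suc: "\<And>i. l \<le> i \<Longrightarrow> f (Suc i) = push (f i)"
    and start_le_1: "sum (f l) (G l) \<le> 1" and end_gt: "5 / 6 < sum (f L) (G L)"
    and x_heavy: "sum (f l) (G l) / 2 \<le> f l x"
begin

abbreviation N :: "nat \<Rightarrow> real" where
  "N i \<equiv> sum (f i) (G i)"

lemma N_Suc: "l \<le> i \<Longrightarrow> i < L \<Longrightarrow> N (Suc i) = (\<Sum>u\<in>G i. keep i u * f i u / 2)"
  by (simp add: f_Suc sum_push_G)

lemma N_antimono:
  assumes "l \<le> i" "i \<le> j" "j \<le> L" shows "N j \<le> N i"
  using assms(2,3)
proof (induction j rule: dec_induct)
  case (step m)
  then have "N (Suc m) \<le> N m" using sum_push_mono[of m "f m"] f_nonneg assms(1) by (simp add: f_Suc)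
  with step show ?case by simp
qed simp

lemma N_gt: "l \<le> i \<Longrightarrow> i \<le> L \<Longrightarrow> 5 / 6 < N i"
  using N_antimono[of i L] end_gt by simp

lemma N_le_1: "l \<le> i \<Longrightarrow> i \<le> L \<Longrightarrow> N i \<le> 1"
  using N_antimono[of l i] start_le_1 by simp

lemma N_leak: "l \<le> i \<Longrightarrow> i < L \<Longrightarrow> u \<in> G i \<Longrightarrow> succ P u b \<notin> G (Suc i) \<Longrightarrow> N (Suc i) \<le> N i - f i u / 2"
  using sum_push_leak[of i "f i" u b] f_nonneg by (simp add: f_Suc)

text \<open>The leak would leave at most 3/4 of the mass, while more than 5/6 has to arrive at level
  \<open>L\<close>.\<close>

lemma no_leak:
  assumes "l \<le> i" "i < L" "u \<in> G i" "N i - f i u / 2 \<le> 3 / 4"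
  shows "succ P u b \<in> G (Suc i)"
  using N_leak[OF assms(1-3), of b] N_gt[of "Suc i"] assms by fastforce

text \<open>The last condition is the one that \<open>full_reach\<close> asks for: all later good
  nodes can be reached from \<open>u\<close>, so literals on different levels never share a
  variable.\<close>

definition lit_ok :: "nat \<Rightarrow> 'v \<Rightarrow> bool" where
  "lit_ok i u \<longleftrightarrow> l \<le> level P u \<and> level P u < i \<and> u \<in> G (level P u) \<and> edge\<^sup>*\<^sup>* x u
     \<and> G (Suc (level P u)) \<subseteq> range (succ P u)"

text \<open>\<open>M\<close> is the mass that the clauses account for: usually \<open>N i\<close>,
  but \<open>N (Suc i)\<close> once the loss at level \<open>i\<close> has been charged. Having at
  most one literal per level makes any two literals comparable by reachability.\<close>

definition base :: "nat \<Rightarrow> real \<Rightarrow> ('v \<times> bool) set set \<Rightarrow> ('v \<times> bool) set \<Rightarrow> bool" where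
  "base i M \<C> R \<longleftrightarrow> finite \<C> \<and> {} \<notin> \<C> \<and> disjoint \<C> \<and> finite (\<Union>\<C> \<union> R) \<and> R \<inter> \<Union>\<C> = {}
     \<and> (\<forall>(u, b)\<in>\<Union>\<C> \<union> R. lit_ok i u) \<and> inj_on (\<lambda>(u, b). level P u) (\<Union>\<C> \<union> R)
     \<and> M \<le> N l * (\<Prod>C\<in>\<C>. 1 - 1 / 2 ^ (card C + 3))"

definition run :: "('v \<times> bool) set set \<Rightarrow> bool list \<Rightarrow> bool" where
  "run \<C> a \<longleftrightarrow> a \<in> cube (nvars P) \<and> node_at P a l = x \<and> sat a \<C>"

text \<open>
  Level by level, the good nodes are in one of three states. \<open>balanced\<close>: no node can leak, since a
  leak would leave at most \<open>3 / 4\<close> of the mass. \<open>skew\<close>: only the node \<open>w\<close> can leak, and if it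
  does, the pending set \<open>R\<close> becomes a clause. \<open>dead\<close>: only \<open>w\<close> can leak, but no input that
  satisfies the clauses is at \<open>w\<close>.
\<close>

definition balanced :: "nat \<Rightarrow> ('v \<times> bool) set set \<Rightarrow> bool" where
  "balanced i \<C> \<longleftrightarrow> (\<forall>v\<in>G i. N i / 4 \<le> f i v \<and> N i - f i v / 2 \<le> 3 / 4 \<and> edge\<^sup>*\<^sup>* x v)
     \<and> (\<forall>a. run \<C> a \<longrightarrow> node_at P a i \<in> G i)"

definition skew :: "nat \<Rightarrow> ('v \<times> bool) set set \<Rightarrow> ('v \<times> bool) set \<Rightarrow> 'v \<Rightarrow> 'v \<Rightarrow> bool" where
  "skew i \<C> R w v \<longleftrightarrow> G i = {w, v} \<and> w \<noteq> v \<and> R \<noteq> {} \<and> N i / 2 ^ (card R + 2) \<le> f i w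
     \<and> N i / 2 \<le> f i v \<and> edge\<^sup>*\<^sup>* x w \<and> edge\<^sup>*\<^sup>* x v
     \<and> (\<forall>a. run \<C> a \<longrightarrow> node_at P a i \<in> G i \<and> (node_at P a i = w \<longrightarrow> agrees a R))"

definition dead :: "nat \<Rightarrow> ('v \<times> bool) set set \<Rightarrow> 'v \<Rightarrow> 'v \<Rightarrow> bool" where
  "dead i \<C> w v \<longleftrightarrow> G i = {w, v} \<and> w \<noteq> v \<and> N i / 2 \<le> f i v \<and> edge\<^sup>*\<^sup>* x v
     \<and> (\<forall>a. run \<C> a \<longrightarrow> node_at P a i = v)"

definition state :: "nat \<Rightarrow> bool" where
  "state i \<longleftrightarrow> (\<exists>\<C> R. base i (N i) \<C> R \<and>
     (R = {} \<and> balanced i \<C> \<or> (\<exists>w v. skew i \<C> R w v) \<or> (\<exists>w v. R = {} \<and> dead i \<C> w v)))"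

lemma stateI_balanced: "base i (N i) \<C> {} \<Longrightarrow> balanced i \<C> \<Longrightarrow> state i"
  and stateI_skew: "base i (N i) \<C> R \<Longrightarrow> skew i \<C> R w v \<Longrightarrow> state i"
  and stateI_dead: "base i (N i) \<C> {} \<Longrightarrow> dead i \<C> w v \<Longrightarrow> state i"
  unfolding state_def by blast+

lemma lit_ok_Suc: "lit_ok i u \<Longrightarrow> lit_ok (Suc i) u"
  by (simp add: lit_ok_def)

lemma base_Suc:
  assumes "base i M \<C> R" "M' \<le> M" shows "base (Suc i) M' \<C> R"
proof -
  have "\<forall>(u, b)\<in>\<Union>\<C> \<union> R. lit_ok (Suc i) u"
    using assms(1) lit_ok_Suc unfolding base_def by blast
  then show ?thesis using assms(1) order_trans[OF assms(2)] unfolding base_def by blast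
qed

lemma base_drop:
  assumes "base i M \<C> R" shows "base i M \<C> {}"
proof -
  have "inj_on (\<lambda>(u, b). level P u) (\<Union>\<C>)"
    using assms by (auto simp: base_def intro: inj_on_subset)
  then show ?thesis using assms by (auto simp: base_def)
qed

lemma base_close:
  assumes "base i M \<C> R" "R \<noteq> {}" "M' \<le> M * (1 - 1 / 2 ^ (card R + 3))"
  shows "base i M' (insert R \<C>) {}"
proof -
  have R: "R \<notin> \<C>" "\<forall>C\<in>\<C>. R \<inter> C = {}" using assms by (auto simp: base_def)
  have fin: "finite \<C>" using assms by (simp add: base_def)
  have "disjoint (insert R \<C>)"
    using assms R unfolding base_def disjoint_def by blast
  moreover have "M' \<le> N l * (\<Prod>C\<in>insert R \<C>. 1 - 1 / 2 ^ (card C + 3))"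
  proof -
    have "(1::real) \<le> 2 ^ (card R + 3)" by (rule one_le_power) simp
    then have "0 \<le> 1 - 1 / (2::real) ^ (card R + 3)" by simp
    then have m: "M * (1 - 1 / 2 ^ (card R + 3))
      \<le> (N l * (\<Prod>C\<in>\<C>. 1 - 1 / 2 ^ (card C + 3))) * (1 - 1 / 2 ^ (card R + 3))"
      using assms(1) by (intro mult_right_mono) (auto simp: base_def)
    show ?thesis using order_trans[OF assms(3) m] fin R(1) by (simp add: mult_ac)
  qed
  moreover have "\<Union>(insert R \<C>) \<union> {} = \<Union>\<C> \<union> R" by auto
  ultimately show ?thesis using assms(1,2) unfolding base_def by simp
qed

lemma base_extend:
  assumes "base i M \<C> R" "M' \<le> M" "l \<le> i" "v \<in> G i" "edge\<^sup>*\<^sup>* x v" "G (Suc i) \<subseteq> range (succ P v)"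
  shows "base (Suc i) M' \<C> (insert (v, b) R)" "card (insert (v, b) R) = Suc (card R)"
proof -
  have v: "level P v = i" using G_node[OF assms(4)] by simp
  have ok: "lit_ok (Suc i) v" using assms v by (simp add: lit_ok_def)
  have lt: "level P u < i" if "(u, b') \<in> \<Union>\<C> \<union> R" for u b'
    using assms(1) that unfolding base_def lit_ok_def by blast
  have nin: "(v, b) \<notin> \<Union>\<C> \<union> R" using lt[of v b] v by auto
  have "level P v \<notin> (\<lambda>(u, b). level P u) ` (\<Union>\<C> \<union> R)"
  proof
    assume "level P v \<in> (\<lambda>(u, b). level P u) ` (\<Union>\<C> \<union> R)"
    then obtain u b' where "(u, b') \<in> \<Union>\<C> \<union> R" "level P u = i" using v by force
    then show False using lt[of u b'] by simp
  qed
  then have inj: "inj_on (\<lambda>(u, b). level P u) (\<Union>\<C> \<union> insert (v, b) R)"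
    using assms(1) nin unfolding base_def by simp
  have R: "finite (\<Union>\<C>)" "finite R" "R \<inter> \<Union>\<C> = {}" using assms(1) by (simp_all add: base_def)
  have "\<forall>(u, b)\<in>\<Union>\<C> \<union> insert (v, b) R. lit_ok (Suc i) u"
    using assms(1) ok lit_ok_Suc unfolding base_def by blast
  moreover have "insert (v, b) R \<inter> \<Union>\<C> = {}" using R nin by blast
  ultimately show "base (Suc i) M' \<C> (insert (v, b) R)"
    using base_Suc[OF assms(1,2)] R inj unfolding base_def by simp
  show "card (insert (v, b) R) = Suc (card R)" using R nin by simp
qed

lemma f_pair:
  assumes "l \<le> i" "i < L" "G i = {w, v}" "w \<noteq> v" "y \<in> G (Suc i)"
  shows "f (Suc i) y = (into w y * f i w + into v y * f i v) / 2"
  using push_G[OF assms(5,2), of "f i"] assms by (simp add: f_Suc field_simps)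

lemma N_pair:
  assumes "l \<le> i" "i < L" "G i = {w, v}" "w \<noteq> v"
  shows "N (Suc i) = (keep i w * f i w + keep i v * f i v) / 2" "N i = f i w + f i v"
  using N_Suc[OF assms(1,2)] assms by (simp_all add: field_simps)

lemma G_Suc_pair:
  assumes "i < L" "G i = {w, v}"
  shows "G (Suc i) \<subseteq> range (succ P w) \<union> range (succ P v)"
proof
  fix y assume "y \<in> G (Suc i)"
  then obtain u where "u \<in> G i" "edge u y" using G_has_pred by blast
  then show "y \<in> range (succ P w) \<union> range (succ P v)" using assms by (auto simp: edge_def)
qed

lemma reach_succ: "edge\<^sup>*\<^sup>* x u \<Longrightarrow> u \<in> G i \<Longrightarrow> i < L \<Longrightarrow> edge\<^sup>*\<^sup>* x (succ P u b)"
  using G_edge[of u i b] by simp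

lemma balanced_single:
  assumes i: "l \<le> i" "i < L" and y: "G (Suc i) = {y}" and r: "edge\<^sup>*\<^sup>* x y"
    and a: "\<And>a. run \<C> a \<Longrightarrow> node_at P a (Suc i) \<in> G (Suc i)"
  shows "balanced (Suc i) \<C>"
  using a r N_le_1[of "Suc i"] i f_nonneg[of "Suc i" y] unfolding balanced_def y by auto

text \<open>The node \<open>succ P v b\<close> is entered only from \<open>v\<close> with answer
  \<open>b\<close>, so it gets exactly half of \<open>f i v\<close>, and being there forces
  \<open>(v, b)\<close> in addition to the answers \<open>R\<close> forced by being at
  \<open>v\<close>. Here \<open>v\<close> may be the light or the heavy node of level
  \<open>i\<close>; in the latter case \<open>R\<close> is empty.\<close>

lemma skew_step:
  assumes i: "l \<le> i" "i < L" and G: "G i = {w, v}" "w \<noteq> v"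
    and v: "succ P v b \<in> G (Suc i)" "succ P v (\<not> b) \<in> G (Suc i)" "succ P v b \<noteq> succ P v (\<not> b)"
    and w: "\<And>b'. succ P w b' = succ P v (\<not> b)"
    and B: "base i (N (Suc i)) \<C> R" "N i / 2 ^ (card R + 2) \<le> f i v"
    and r: "edge\<^sup>*\<^sup>* x v"
    and a: "\<And>a. run \<C> a \<Longrightarrow> node_at P a i \<in> G i \<and> (node_at P a i = v \<longrightarrow> agrees a R)"
  shows "state (Suc i)"
proof (rule stateI_skew)
  let ?y = "succ P v b" and ?z = "succ P v (\<not> b)"
  have vG: "v \<in> G i" using G by simp
  have cG: "card (G (Suc i)) \<le> 2" using card_G i by simp
  have "G (Suc i) \<subseteq> range (succ P w) \<union> range (succ P v)" using G_Suc_pair i G by blast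
  moreover have "range (succ P w) \<subseteq> {?z}" using w by blast
  moreover have "range (succ P v) \<subseteq> {?y, ?z}" by (cases b) (auto simp: UNIV_bool)
  ultimately have G': "G (Suc i) = {?y, ?z}" using v by blast
  have d: "keep i w = 2" "keep i v = 2" using v w by (cases b; simp)+
  note N = N_pair[OF i G, unfolded d]
  have fy: "f (Suc i) ?y = f i v / 2"
    using f_pair[OF i G v(1)] v(3) w by (cases b) auto
  have fz: "f (Suc i) ?z = f i w + f i v / 2"
    using f_pair[OF i G v(2)] v(3) w by (cases b) (auto simp: field_simps)
  have sub: "G (Suc i) \<subseteq> range (succ P v)" using G' by auto
  show "base (Suc i) (N (Suc i)) \<C> (insert (v, b) R)"
    by (rule base_extend(1)[OF B(1) order_refl i(1) vG r sub])
  have card: "card (insert (v, b) R) = Suc (card R)"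
    by (rule base_extend(2)[OF B(1) order_refl i(1) vG r sub])
  show "skew (Suc i) \<C> (insert (v, b) R) ?y ?z"
    unfolding skew_def
  proof (intro conjI allI impI)
    show "G (Suc i) = {?y, ?z}" by (rule G')
    show "N (Suc i) / 2 ^ (card (insert (v, b) R) + 2) \<le> f (Suc i) ?y"
      using B(2) N unfolding card fy by (simp add: field_simps)
    show "N (Suc i) / 2 \<le> f (Suc i) ?z"
      using N f_nonneg[of i w] unfolding fz by (simp add: field_simps)
    show "edge\<^sup>*\<^sup>* x ?y" "edge\<^sup>*\<^sup>* x ?z" using reach_succ[OF r vG i(2)] by auto
    fix a assume "run \<C> a"
    note a = a[OF this]
    then consider "node_at P a i = w" | "node_at P a i = v" "agrees a R" using G by auto
    then have *: "node_at P a (Suc i) = ?z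
      \<or> node_at P a (Suc i) = succ P v (a ! var P v) \<and> agrees a R"
      by cases (auto simp: w)
    then show "node_at P a (Suc i) \<in> G (Suc i)" using v by (cases "a ! var P v"; cases b) auto
    show "agrees a (insert (v, b) R)" if "node_at P a (Suc i) = ?y"
    proof -
      from * that v(3) have "succ P v (a ! var P v) = ?y" "agrees a R" by auto
      with v(3) show ?thesis by (cases "a ! var P v"; cases b) (auto simp: agrees_def)
    qed
  qed (use v in auto)
qed

text \<open>As \<open>v\<close> has two different good successors, each gets at least
  \<open>f i v / 2\<close>. If \<open>w\<close> splits in the same way, each gets half of
  \<open>N i\<close>. If \<open>w\<close> leaks, \<open>v\<close> is heavy and the new total is at
  most \<open>f i w / 2 + f i v\<close>; one more leak would then leave at most
  \<open>f i w / 2 + 3 * f i v / 4\<close>, which is at most 3/4.\<close>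

lemma balanced_halves:
  assumes i: "l \<le> i" "i < L" and G: "G i = {w, v}" "w \<noteq> v"
    and v: "\<And>b. succ P v b \<in> G (Suc i)" "succ P v False \<noteq> succ P v True"
    and w: "succ P w False = succ P w True \<Longrightarrow> succ P w False \<notin> G (Suc i)"
    and B: "base i (N (Suc i)) \<C> {}" and vw: "(\<exists>b. succ P w b \<notin> G (Suc i)) \<Longrightarrow> N i / 2 \<le> f i v"
    and r: "edge\<^sup>*\<^sup>* x v"
    and a: "\<And>a. run \<C> a \<Longrightarrow> node_at P a (Suc i) \<in> G (Suc i)"
  shows "state (Suc i)"
proof (rule stateI_balanced)
  have cG: "card (G (Suc i)) \<le> 2" using card_G i by simp
  have G': "G (Suc i) = {succ P v False, succ P v True}"
  proof (rule sym, rule card_seteq)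
    show "card (G (Suc i)) \<le> card {succ P v False, succ P v True}" using cG v by simp
  qed (use v in auto)
  have N1: "N i \<le> 1" using N_le_1 i by simp
  note N = N_pair[OF i G]
  have dv: "keep i v = 2" using v by simp
  have nn: "0 \<le> f i w" "0 \<le> f i v" using f_nonneg by auto
  have val: "N (Suc i) / 4 \<le> f (Suc i) y \<and> N (Suc i) - f (Suc i) y / 2 \<le> 3 / 4" if y: "y \<in> G (Suc i)" for y
  proof -
    have cv: "into v y = 1" using y v(2) unfolding G' by auto
    have fy: "f (Suc i) y = (into w y * f i w + f i v) / 2"
      using f_pair[OF i G y] unfolding cv by simp
    show ?thesis
    proof (cases "\<forall>b. succ P w b \<in> G (Suc i)")
      case True
      then have "succ P w False \<noteq> succ P w True" "succ P w False \<in> G (Suc i)" "succ P w True \<in> G (Suc i)"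
        using w by blast+
      then have "into w y = 1" using y unfolding G' by auto
      moreover have "keep i w = 2" using True by simp
      ultimately show ?thesis using fy N N1 nn unfolding dv by simp
    next
      case False
      then obtain b where "succ P w b \<notin> G (Suc i)" by blast
      then have "keep i w \<le> 1" by (cases b) (auto simp: of_bool_def)
      then have "keep i w * f i w \<le> f i w" using nn mult_right_mono by fastforce
      then have N': "N (Suc i) \<le> f i w / 2 + f i v" using N(1) unfolding dv by simp
      have "N i / 2 \<le> f i v" using False vw by blast
      moreover have "f i v / 2 \<le> f (Suc i) y" using fy nn by simp
      ultimately show ?thesis using N' N(2) N1 nn by simp
    qed
  qed
  have "edge\<^sup>*\<^sup>* x (succ P v b)" for b by (rule reach_succ[OF r _ i(2)]) (simp add: G)
  then have "edge\<^sup>*\<^sup>* x y" if "y \<in> G (Suc i)" for y using that unfolding G' by blast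
  then show "balanced (Suc i) \<C>" unfolding balanced_def using val a by blast
  show "base (Suc i) (N (Suc i)) \<C> {}" by (rule base_Suc[OF B order_refl])
qed

lemma G_Suc_eq:
  assumes "l \<le> i" "i < L" "y \<in> G (Suc i)" "z \<in> G (Suc i)" "y \<noteq> z"
  shows "G (Suc i) = {y, z}"
proof (rule sym, rule card_seteq)
  show "card (G (Suc i)) \<le> card {y, z}" using card_G[of "Suc i"] assms by simp
qed (use assms in auto)

lemma N_no_leak:
  assumes "l \<le> i" "i < L" "\<And>u b. u \<in> G i \<Longrightarrow> succ P u b \<in> G (Suc i)" shows "N (Suc i) = N i"
  unfolding N_Suc[OF assms(1,2)] using assms(3) by (intro sum.cong) auto

lemma range_succ_not: "y \<in> range (succ P v) \<Longrightarrow> \<exists>b. y = succ P v (\<not> b)"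
  by (erule rangeE) (rule_tac x = "\<not> x" in exI, simp)

text \<open>The next level has at most two good nodes, so they are the two successors of
  \<open>u\<close>, and the single successor of \<open>u'\<close> is one of them; \<open>b\<close>
  is the answer that leads to the other.\<close>

lemma split_full:
  assumes i: "l \<le> i" "i < L" and u: "\<And>b. succ P u b \<in> G (Suc i)" and u': "\<And>b. succ P u' b \<in> G (Suc i)"
    and ne: "succ P u False \<noteq> succ P u True" and eq: "succ P u' False = succ P u' True"
  shows "\<exists>b. succ P u b \<noteq> succ P u (\<not> b) \<and> (\<forall>b'. succ P u' b' = succ P u (\<not> b))"
proof -
  have "G (Suc i) = {succ P u False, succ P u True}" by (rule G_Suc_eq[OF i u u ne])
  moreover have "succ P u' False \<in> G (Suc i)" by (rule u')
  ultimately have "succ P u' False \<in> range (succ P u)" by (metis insertE rangeI singletonD)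
  from range_succ_not[OF this] obtain b where b: "succ P u' False = succ P u (\<not> b)" by blast
  have "succ P u' b' = succ P u (\<not> b)" for b' using eq b by (cases b') auto
  moreover have "succ P u b \<noteq> succ P u (\<not> b)" using ne by (cases b) auto
  ultimately show ?thesis by blast
qed

text \<open>The mass bound is assumed for \<open>N (Suc i)\<close> already: leaks from the dead node
  cost no clause, and \<open>skew_leak_step\<close> can pay for a leak first and then continue from
  the same level.\<close>

lemma dead_step:
  assumes i: "l \<le> i" "i < L" and B: "base i (N (Suc i)) \<C> {}" and D: "dead i \<C> w v"
  shows "state (Suc i)"
proof -
  have G: "G i = {w, v}" "w \<noteq> v" and vN: "N i / 2 \<le> f i v" and r: "edge\<^sup>*\<^sup>* x v"
    and a: "\<And>a. run \<C> a \<Longrightarrow> node_at P a i = v" using D unfolding dead_def by blast+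
  have N1: "N i \<le> 1" using N_le_1 i by simp
  have vG: "v \<in> G i" using G by simp
  have v: "succ P v b \<in> G (Suc i)" for b
    by (rule no_leak[OF i vG]) (use vN N1 in simp)
  have a': "node_at P a (Suc i) = succ P v (a ! var P v)" if "run \<C> a" for a
    using a[OF that] by simp
  then have aG: "node_at P a (Suc i) \<in> G (Suc i)" if "run \<C> a" for a
    using v that by (simp del: node_at.simps)
  have B': "base (Suc i) (N (Suc i)) \<C> {}" by (rule base_Suc[OF B order_refl])
  show ?thesis
  proof (cases "succ P v False = succ P v True")
    case True
    define v' where "v' = succ P v True"
    have full: "succ P v b = v'" for b using True by (cases b) (auto simp: v'_def)
    have v': "v' \<in> G (Suc i)" "edge\<^sup>*\<^sup>* x v'" using v reach_succ[OF r vG i(2)] by (auto simp: v'_def)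
    show ?thesis
    proof (cases "G (Suc i) = {v'}")
      case True
      from stateI_balanced[OF B' balanced_single[OF i True v'(2) aG]] show ?thesis .
    next
      case False
      \<comment> \<open>The node \<open>w'\<close> may get mass from \<open>w\<close>, but every run
        comes from \<open>v\<close> and moves to \<open>v'\<close>, so \<open>w'\<close> is dead
        again.\<close>
      then obtain w' where w': "w' \<in> G (Suc i)" "w' \<noteq> v'" using v'(1) by blast
      have "f (Suc i) v' = (into w v' * f i w + into v v' * f i v) / 2" by (rule f_pair[OF i G v'(1)])
      moreover have "into v v' = 2" using full by simp
      moreover have "0 \<le> into w v' * f i w" using f_nonneg by simp
      ultimately have "f i v \<le> f (Suc i) v'" by simp
      moreover have "N (Suc i) \<le> N i" using N_antimono[of i "Suc i"] i by simp
      ultimately have "N (Suc i) / 2 \<le> f (Suc i) v'" using vN by linarith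
      then have "dead (Suc i) \<C> w' v'"
        unfolding dead_def using G_Suc_eq[OF i w'(1) v'(1) w'(2)] w'(2) v'(2) a' full
        by (simp del: node_at.simps)
      from stateI_dead[OF B' this] show ?thesis .
    qed
  next
    case False
    show ?thesis
    proof (cases "succ P w False = succ P w True \<and> succ P w False \<in> G (Suc i)")
      case True
      have "G (Suc i) = {succ P v False, succ P v True}" by (rule G_Suc_eq[OF i v v False])
      with True have "succ P w False \<in> range (succ P v)" by (metis insertE rangeI singletonD)
      from range_succ_not[OF this] obtain b where b: "succ P w False = succ P v (\<not> b)" by blast
      have w: "succ P w b' = succ P v (\<not> b)" for b' using True b by (cases b') auto
      have ne: "succ P v b \<noteq> succ P v (\<not> b)" using False by (cases b) auto
      show ?thesis
        
      proof (rule skew_step[OF i G v v ne w B _ r])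
        show "N i / 2 ^ (card ({} :: ('v \<times> bool) set) + 2) \<le> f i v" using vN N_gt[of i] i by simp
        show "node_at P a i \<in> G i \<and> (node_at P a i = v \<longrightarrow> agrees a {})" if "run \<C> a" for a
          using a[OF that] G by (simp add: agrees_def)
      qed
    next
      case nf: False
      show ?thesis
        by (rule balanced_halves[OF i G v False _ B vN r aG]) (use nf in auto)
    qed
  qed
qed

text \<open>Turning \<open>R\<close> into a clause excludes all runs at \<open>w\<close>, which
  makes the level dead. The leak takes half of \<open>f i w\<close>, at least
  \<open>N i / 2 ^ (card R + 3)\<close>, and this pays for the factor of the clause.\<close>

lemma skew_leak_step:
  assumes i: "l \<le> i" "i < L" and B: "base i (N i) \<C> R" and S: "skew i \<C> R w v"
    and w: "succ P w b \<notin> G (Suc i)"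
  shows "state (Suc i)"
proof (rule dead_step[OF i])
  have G: "G i = {w, v}" "w \<noteq> v" and R: "R \<noteq> {}" and wN: "N i / 2 ^ (card R + 2) \<le> f i w"
    using S unfolding skew_def by blast+
  have "N (Suc i) \<le> N i - f i w / 2" by (rule N_leak[OF i _ w]) (use G in simp)
  also have "\<dots> \<le> N i * (1 - 1 / 2 ^ (card R + 3))" using wN by (simp add: field_simps power_add)
  finally show "base i (N (Suc i)) (insert R \<C>) {}" by (rule base_close[OF B R])
  have "node_at P a i = v" if "run (insert R \<C>) a" for a
  proof -
    have "run \<C> a" "\<not> agrees a R" using that unfolding run_def sat_insert by blast+
    then show ?thesis using S unfolding skew_def by blast
  qed
  then show "dead i (insert R \<C>) w v" using S unfolding dead_def skew_def by blast
qed

text \<open>Nothing leaks, so all depends on which nodes have two different successors. If only the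
  light \<open>w\<close> does, \<open>R\<close> grows; if only the heavy \<open>v\<close> does,
  \<open>R\<close> is discarded and a new pending set starts at \<open>v\<close>; if both do, the
  level becomes balanced; if neither does, the nodes move on or merge.\<close>

lemma skew_keep_step:
  assumes i: "l \<le> i" "i < L" and B: "base i (N i) \<C> R" and S: "skew i \<C> R w v"
    and w: "\<And>b. succ P w b \<in> G (Suc i)"
  shows "state (Suc i)"
proof -
  have G: "G i = {w, v}" "w \<noteq> v" and R: "R \<noteq> {}" and wN: "N i / 2 ^ (card R + 2) \<le> f i w"
    and vN: "N i / 2 \<le> f i v" and rw: "edge\<^sup>*\<^sup>* x w" and r: "edge\<^sup>*\<^sup>* x v"
    and a: "\<And>a. run \<C> a \<Longrightarrow> node_at P a i \<in> G i \<and> (node_at P a i = w \<longrightarrow> agrees a R)"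
    using S unfolding skew_def by blast+
  have G2: "G i = {v, w}" "v \<noteq> w" using G by auto
  have N1: "N i \<le> 1" "0 < N i" using N_le_1 N_gt[of i] i by simp_all
  have vG: "v \<in> G i" "w \<in> G i" using G by simp_all
  have v: "succ P v b \<in> G (Suc i)" for b
    by (rule no_leak[OF i vG(1)]) (use vN N1 in simp)
  have all: "succ P u b \<in> G (Suc i)" if "u \<in> G i" for u b using that v w G by auto
  have N': "N (Suc i) = N i" by (rule N_no_leak[OF i all])
  have aG: "node_at P a (Suc i) \<in> G (Suc i)" if "run \<C> a" for a
    using a[OF that] all by simp
  note B0 = base_drop[OF B, folded N']
  note B' = base_Suc[OF B order_refl, folded N']
  have a0: "\<And>a. run \<C> a \<Longrightarrow> node_at P a i \<in> G i \<and> (node_at P a i = v \<longrightarrow> agrees a {})"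
    using a by (simp add: agrees_def)
  have half: "\<exists>b. succ P u b \<noteq> succ P u (\<not> b) \<and> (\<forall>b'. succ P u' b' = succ P u (\<not> b))"
    if "u \<in> G i" "u' \<in> G i" "succ P u False \<noteq> succ P u True" "succ P u' False = succ P u' True" for u u'
    by (rule split_full[OF i all[OF that(1)] all[OF that(2)] that(3,4)])
  show ?thesis
  proof (cases "succ P v False = succ P v True"; cases "succ P w False = succ P w True")
    assume vf: "succ P v False = succ P v True" and wf: "succ P w False = succ P w True"
    define v' w' where "v' = succ P v True" and "w' = succ P w True"
    have full: "succ P v b = v'" "succ P w b = w'" for b
      using vf wf by (cases b; simp add: v'_def w'_def)+
    have r': "edge\<^sup>*\<^sup>* x v'" "edge\<^sup>*\<^sup>* x w'" and G': "v' \<in> G (Suc i)" "w' \<in> G (Suc i)"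
      using reach_succ[OF r vG(1) i(2)] reach_succ[OF rw vG(2) i(2)] v w by (auto simp: v'_def w'_def)
    have sub: "G (Suc i) \<subseteq> {v', w'}" using G_Suc_pair[OF i(2) G(1)] full by auto
    show ?thesis
    proof (cases "v' = w'")
      case True
      then have "G (Suc i) = {v'}" using sub G' by auto
      from stateI_balanced[OF base_Suc[OF B0 order_refl] balanced_single[OF i this r'(1) aG]] show ?thesis .
    next
      case False
      have "f (Suc i) v' = f i v" "f (Suc i) w' = f i w"
        using f_pair[OF i G G'(1)] f_pair[OF i G G'(2)] full False by auto
      moreover have "agrees a R" if "run \<C> a" "node_at P a (Suc i) = w'" for a
        using a[OF that(1)] that(2) full False G by auto
      moreover have "G (Suc i) = {w', v'}" using sub G' by blast
      ultimately have "skew (Suc i) \<C> R w' v'"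
        unfolding skew_def using False r' R wN vN N' aG by (simp del: node_at.simps)
      from stateI_skew[OF B' this] show ?thesis .
    qed
  next
    assume "succ P v False = succ P v True" "succ P w False \<noteq> succ P w True"
    from half[OF vG(2,1) this(2,1)] obtain b where b: "succ P w b \<noteq> succ P w (\<not> b)"
      "\<And>b'. succ P v b' = succ P w (\<not> b)" by blast
    show ?thesis by (rule skew_step[OF i G2 w w b(1) b(2) B[folded N'] _ rw a]) (use wN in simp)
  next
    assume "succ P v False \<noteq> succ P v True" "succ P w False = succ P w True"
    from half[OF vG this] obtain b where b: "succ P v b \<noteq> succ P v (\<not> b)"
      "\<And>b'. succ P w b' = succ P v (\<not> b)" by blast
    show ?thesis by (rule skew_step[OF i G v v b(1) b(2) B0 _ r a0]) (use vN N1 in simp)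
  next
    assume "succ P v False \<noteq> succ P v True" "succ P w False \<noteq> succ P w True"
    then show ?thesis by (intro balanced_halves[OF i G v _ _ B0 _ r aG]) (use w in auto)
  qed
qed

end

section \<open>Sets of literals with distinct variables\<close>

context read_once_bp
begin

text \<open>Comparability by reachability is what \<open>var_neq\<close> turns into distinct
  variables. Levels grow along edges, so both answers at one node are excluded as well.\<close>

definition chained :: "('v \<times> bool) set \<Rightarrow> bool" where
  "chained X \<longleftrightarrow> (\<forall>p\<in>X. fst p \<in> nodes P - sinks P)
     \<and> (\<forall>p\<in>X. \<forall>q\<in>X. p = q \<or> edge\<^sup>+\<^sup>+ (fst p) (fst q) \<or> edge\<^sup>+\<^sup>+ (fst q) (fst p))"

definition clauses :: "('v \<times> bool) set set \<Rightarrow> bool" where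
  "clauses \<C> \<longleftrightarrow> finite \<C> \<and> {} \<notin> \<C> \<and> disjoint \<C> \<and> finite (\<Union>\<C>) \<and> chained (\<Union>\<C>)"

definition weight :: "('v \<times> bool) set set \<Rightarrow> real" where
  "weight \<C> = (\<Prod>C\<in>\<C>. 1 - 1 / 2 ^ (card C + 3))"

lemma weight_nonneg: "0 \<le> weight \<C>"
  unfolding weight_def by (intro prod_nonneg) (simp add: one_le_power)

lemma chained_inj:
  assumes "chained X" shows "inj_on (\<lambda>p. var P (fst p)) X"
proof (rule inj_onI, rule ccontr)
  fix p q assume *: "p \<in> X" "q \<in> X" "var P (fst p) = var P (fst q)" "p \<noteq> q"
  then consider "edge\<^sup>+\<^sup>+ (fst p) (fst q)" | "edge\<^sup>+\<^sup>+ (fst q) (fst p)"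
    using assms unfolding chained_def by blast
  then show False
    using * assms var_neq[of "fst p" "fst q"] var_neq[of "fst q" "fst p"]
    unfolding chained_def by cases auto
qed

lemma chained_Un:
  assumes "chained X" "chained Y" "\<And>p q. p \<in> X \<Longrightarrow> q \<in> Y \<Longrightarrow> edge\<^sup>+\<^sup>+ (fst p) (fst q)"
  shows "chained (X \<union> Y)" "X \<inter> Y = {}"
proof -
  show "chained (X \<union> Y)" using assms unfolding chained_def by blast
  show "X \<inter> Y = {}"
  proof (rule ccontr)
    assume "X \<inter> Y \<noteq> {}"
    then obtain p where p: "p \<in> X" "p \<in> Y" by blast
    with assms(1) have "fst p \<in> nodes P - sinks P" unfolding chained_def by blast
    from var_neq[OF assms(3)[OF p] this] show False by simp
  qed
qed

lemma clauses_Un: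
  assumes "clauses \<C>" "clauses \<D>"
    and "\<And>p q. p \<in> \<Union>\<C> \<Longrightarrow> q \<in> \<Union>\<D> \<Longrightarrow> edge\<^sup>+\<^sup>+ (fst p) (fst q)"
  shows "clauses (\<C> \<union> \<D>)" "weight (\<C> \<union> \<D>) = weight \<C> * weight \<D>"
proof -
  have "chained (\<Union>\<C> \<union> \<Union>\<D>)" and dis: "\<Union>\<C> \<inter> \<Union>\<D> = {}"
    using chained_Un[of "\<Union>\<C>" "\<Union>\<D>"] assms unfolding clauses_def by blast+
  moreover have "disjoint (\<C> \<union> \<D>)"
    using assms(1,2) dis by (intro disjoint_union) (simp_all add: clauses_def)
  ultimately show "clauses (\<C> \<union> \<D>)" using assms(1,2) by (simp add: clauses_def)
  have "\<C> \<inter> \<D> = {}"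
  proof (rule ccontr)
    assume "\<C> \<inter> \<D> \<noteq> {}"
    then obtain C where C: "C \<in> \<C>" "C \<in> \<D>" by blast
    then have "C \<noteq> {}" using assms(1) by (auto simp: clauses_def)
    then show False using C dis by blast
  qed
  then show "weight (\<C> \<union> \<D>) = weight \<C> * weight \<D>"
    using assms(1,2) unfolding weight_def clauses_def by (intro prod.union_disjoint) blast+
qed

end

section \<open>The run from level \<open>l\<close> to the target\<close>

context clause_run
begin

text \<open>No node can leak, and each holds at least \<open>N i / 4\<close>, which is the bound
  that \<open>skew_step\<close> demands for an empty pending set. Hence either of two nodes may be
  the one that splits.\<close>

lemma balanced_step:
  assumes i: "l \<le> i" "i < L" and B: "base i (N i) \<C> {}" and S: "balanced i \<C>"
  shows "state (Suc i)"
proof -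
  have m: "N i / 4 \<le> f i u" "N i - f i u / 2 \<le> 3 / 4" "edge\<^sup>*\<^sup>* x u" if "u \<in> G i" for u
    using S that unfolding balanced_def by blast+
  have a: "node_at P a i \<in> G i" if "run \<C> a" for a
    using S that unfolding balanced_def by blast
  have all: "succ P u b \<in> G (Suc i)" if "u \<in> G i" for u b
    by (rule no_leak[OF i that m(2)[OF that]])
  have N': "N (Suc i) = N i" by (rule N_no_leak[OF i all])
  have N1: "N i \<le> 1" "0 < N i" using N_le_1 N_gt[of i] i by simp_all
  note B0 = B[folded N']
  note B' = base_Suc[OF B0 order_refl]
  have aG: "node_at P a (Suc i) \<in> G (Suc i)" if "run \<C> a" for a
    using a[OF that] all by simp
  have reach: "edge\<^sup>*\<^sup>* x y" if y: "y \<in> G (Suc i)" for y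
  proof -
    obtain u where u: "u \<in> G i" "edge u y" using G_has_pred[OF y] by blast
    then show ?thesis using m(3)[OF u(1)] by simp
  qed
  have bal: "state (Suc i)" if "\<And>y. y \<in> G (Suc i) \<Longrightarrow> N i / 4 \<le> f (Suc i) y \<and> N i - f (Suc i) y / 2 \<le> 3 / 4"
    using that reach aG N' by (intro stateI_balanced[OF B']) (simp add: balanced_def del: node_at.simps)
  have card: "card (G i) \<le> 2" using card_G i by simp
  have "G i \<noteq> {}" using N1 by auto
  then have "card (G i) \<noteq> 0" by simp
  with card consider "card (G i) = 1" | "card (G i) = 2" by linarith
  then show ?thesis
  proof cases
    case 1
    then obtain u where u: "G i = {u}" by (auto simp: card_Suc_eq)
    have "N i / 2 \<le> f (Suc i) y" if y: "y \<in> G (Suc i)" for y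
    proof -
      have "edge u y" using G_has_pred[OF y] u by auto
      then have "1 \<le> into u y" by (auto simp: edge_def of_bool_def) (metis (full_types))
      moreover have "f (Suc i) y = into u y * f i u / 2"
        using push_G[OF y i(2), of "f i"] u i by (simp add: f_Suc)
      ultimately show ?thesis using u N1 mult_right_mono[of 1 "into u y" "f i u"] by simp
    qed
    then show ?thesis using N1 by (intro bal) fastforce
  next
    case 2
    then obtain w v where G: "G i = {w, v}" "w \<noteq> v" by (auto simp: card_2_iff)
    have G2: "G i = {v, w}" "v \<noteq> w" using G by auto
    have vG: "v \<in> G i" "w \<in> G i" using G by simp_all
    have a0: "\<And>a. run \<C> a \<Longrightarrow> node_at P a i \<in> G i \<and> (node_at P a i = u \<longrightarrow> agrees a {})" for u
      using a by (simp add: agrees_def)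
    have q: "N i / 2 ^ (card ({} :: ('v \<times> bool) set) + 2) \<le> f i u" if "u \<in> G i" for u
      using m(1)[OF that] by simp
    have half: "\<exists>b. succ P u b \<noteq> succ P u (\<not> b) \<and> (\<forall>b'. succ P u' b' = succ P u (\<not> b))"
      if "u \<in> G i" "u' \<in> G i" "succ P u False \<noteq> succ P u True" "succ P u' False = succ P u' True" for u u'
      by (rule split_full[OF i all[OF that(1)] all[OF that(2)] that(3,4)])
    show ?thesis
    proof (cases "succ P v False = succ P v True"; cases "succ P w False = succ P w True")
      assume vf: "succ P v False = succ P v True" and wf: "succ P w False = succ P w True"
      define v' w' where "v' = succ P v True" and "w' = succ P w True"
      have full: "succ P v b = v'" "succ P w b = w'" for b
        using vf wf by (cases b; simp add: v'_def w'_def)+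
      have G': "v' \<in> G (Suc i)" "w' \<in> G (Suc i)" using all vG by (simp_all add: v'_def w'_def)
      have sub: "G (Suc i) \<subseteq> {v', w'}" using G_Suc_pair[OF i(2) G(1)] full by auto
      have ge: "f i v \<le> f (Suc i) v'" "f i w \<le> f (Suc i) w'"
        using f_pair[OF i G G'(1)] f_pair[OF i G G'(2)] full
          f_nonneg[of i w] f_nonneg[of i v] by (cases "v' = w'"; simp)+
      show ?thesis
      proof (rule bal)
        fix y assume "y \<in> G (Suc i)"
        then have "y = v' \<or> y = w'" using sub by blast
        then show "N i / 4 \<le> f (Suc i) y \<and> N i - f (Suc i) y / 2 \<le> 3 / 4"
          using ge m[OF vG(1)] m[OF vG(2)] by auto
      qed
    next
      assume "succ P v False = succ P v True" "succ P w False \<noteq> succ P w True"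
      from half[OF vG(2,1) this(2,1)] obtain b where b: "succ P w b \<noteq> succ P w (\<not> b)"
        "\<And>b'. succ P v b' = succ P w (\<not> b)" by blast
      show ?thesis
        by (rule skew_step[OF i G2 all[OF vG(2)] all[OF vG(2)] b B0 q[OF vG(2)] m(3)[OF vG(2)] a0])
    next
      assume "succ P v False \<noteq> succ P v True" "succ P w False = succ P w True"
      from half[OF vG this] obtain b where b: "succ P v b \<noteq> succ P v (\<not> b)"
        "\<And>b'. succ P w b' = succ P v (\<not> b)" by blast
      show ?thesis
        by (rule skew_step[OF i G all[OF vG(1)] all[OF vG(1)] b B0 q[OF vG(1)] m(3)[OF vG(1)] a0])
    next
      assume h: "succ P v False \<noteq> succ P v True" "succ P w False \<noteq> succ P w True"
      show ?thesis
        by (rule balanced_halves[OF i G all[OF vG(1)] h(1) _ B0 _ m(3)[OF vG(1)] aG])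
          (use h all[OF vG(2)] in auto)
    qed
  qed
qed

text \<open>A run is at \<open>x\<close> by definition and \<open>x\<close> is heavy, so a second
  good node of level \<open>l\<close> is dead from the outset.\<close>

lemma state_start: "state l"
proof -
  have B: "base l (N l) {} {}" by (simp add: base_def)
  have N1: "N l \<le> 1" "0 < N l" using N_le_1[of l] N_gt[of l] l_le by simp_all
  show ?thesis
  proof (cases "G l = {x}")
    case True
    then have "balanced l {}" using N1 by (auto simp: balanced_def run_def)
    with B show ?thesis by (rule stateI_balanced)
  next
    case False
    then obtain w where w: "w \<in> G l" "w \<noteq> x" using x_G by blast
    have "G l = {w, x}"
    proof (rule sym, rule card_seteq)
      show "card (G l) \<le> card {w, x}" using card_G[of l] l_le w by simp
    qed (use w x_G in auto)
    then have "dead l {} w x" unfolding dead_def using w x_heavy by (auto simp: run_def)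
    with B show ?thesis by (rule stateI_dead)
  qed
qed

lemma state_all:
  assumes "l \<le> i" "i \<le> L" shows "state i"
  using assms
proof (induction i rule: dec_induct)
  case base
  show ?case by (rule state_start)
next
  case (step i)
  then have i: "l \<le> i" "i < L" and "state i" by simp_all
  then obtain \<C> R where B: "base i (N i) \<C> R"
    and S: "R = {} \<and> balanced i \<C> \<or> (\<exists>w v. skew i \<C> R w v) \<or> (\<exists>w v. R = {} \<and> dead i \<C> w v)"
    unfolding state_def by blast
  from S consider "R = {}" "balanced i \<C>" | w v where "skew i \<C> R w v"
    | w v where "R = {}" "dead i \<C> w v" by blast
  then show ?case
  proof cases
    case 1
    then show ?thesis using balanced_step[OF i, of \<C>] B by simp
  next
    case (2 w v)
    then show ?thesis using skew_keep_step[OF i B 2] skew_leak_step[OF i B 2] by blast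
  next
    case (3 w v)
    \<comment> \<open>A leak from the dead node only lowers the mass to be accounted for; no clause
      is added.\<close>
    have "N (Suc i) \<le> N i" using N_antimono[of i "Suc i"] i by simp
    then have "base i (N (Suc i)) \<C> {}" using B 3(1) unfolding base_def by auto
    from dead_step[OF i this 3(2)] show ?thesis .
  qed
qed

lemma clauses_exist:
  obtains \<C> where "clauses \<C>" "\<And>p. p \<in> \<Union>\<C> \<Longrightarrow> edge\<^sup>*\<^sup>* x (fst p)"
    "\<And>p t. p \<in> \<Union>\<C> \<Longrightarrow> t \<in> T \<Longrightarrow> edge\<^sup>+\<^sup>+ (fst p) t"
    "N L \<le> N l * weight \<C>"
    "\<And>a. a \<in> cube (nvars P) \<Longrightarrow> node_at P a l = x \<Longrightarrow> sat a \<C> \<Longrightarrow> node_at P a L \<in> T"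
proof -
  from state_all[OF l_le order_refl] obtain \<C> R where B0: "base L (N L) \<C> R"
    and S: "R = {} \<and> balanced L \<C> \<or> (\<exists>w v. skew L \<C> R w v) \<or> (\<exists>w v. R = {} \<and> dead L \<C> w v)"
    unfolding state_def by blast
  have B: "base L (N L) \<C> {}" by (rule base_drop[OF B0])
  then have fin: "finite \<C>" "{} \<notin> \<C>" "disjoint \<C>" "finite (\<Union>\<C>)"
    and inj: "inj_on (\<lambda>(u, b). level P u) (\<Union>\<C>)"
    and W: "N L \<le> N l * weight \<C>" by (simp_all add: base_def weight_def)
  have lit: "lit_ok L (fst p)" if "p \<in> \<Union>\<C>" for p
    using B that unfolding base_def by fastforce
  have fr: "edge\<^sup>+\<^sup>+ (fst p) y" if "p \<in> \<Union>\<C>" "level P (fst p) < j" "y \<in> G j" for p y j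
    using lit[OF that(1)] that(2,3) full_reach[of "fst p" "level P (fst p)" j y]
    unfolding lit_ok_def by blast
  have "chained (\<Union>\<C>)"
    unfolding chained_def
  proof (intro conjI ballI)
    fix p assume "p \<in> \<Union>\<C>"
    from lit[OF this] show "fst p \<in> nodes P - sinks P"
      unfolding lit_ok_def using G_nonsink by blast
  next
    fix p q assume pq: "p \<in> \<Union>\<C>" "q \<in> \<Union>\<C>"
    have "p = q \<or> level P (fst p) < level P (fst q) \<or> level P (fst q) < level P (fst p)"
      using inj_onD[OF inj[unfolded case_prod_unfold] _ pq] by (meson nat_neq_iff)
    moreover have "fst p \<in> G (level P (fst p))" "fst q \<in> G (level P (fst q))"
      using lit pq unfolding lit_ok_def by blast+
    ultimately show "p = q \<or> edge\<^sup>+\<^sup>+ (fst p) (fst q) \<or> edge\<^sup>+\<^sup>+ (fst q) (fst p)"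
      using fr pq by blast
  qed
  with fin have "clauses \<C>" by (simp add: clauses_def)
  moreover have "edge\<^sup>*\<^sup>* x (fst p)" if "p \<in> \<Union>\<C>" for p
    using lit[OF that] unfolding lit_ok_def by blast
  moreover have "edge\<^sup>+\<^sup>+ (fst p) t" if "p \<in> \<Union>\<C>" "t \<in> T" for p t
    using fr[OF that(1), of L t] lit[OF that(1)] that(2) unfolding lit_ok_def G_L by blast
  moreover have "node_at P a L \<in> T" if "a \<in> cube (nvars P)" "node_at P a l = x" "sat a \<C>" for a
  proof -
    have r: "run \<C> a" using that by (simp add: run_def)
    have "node_at P a L \<in> G L"
      using S
    proof (elim disjE exE conjE)
      show ?thesis if "balanced L \<C>" using that r unfolding balanced_def by blast
      show ?thesis if "skew L \<C> R w v" for w v using that r unfolding skew_def by blast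
      show ?thesis if "dead L \<C> w v" for w v using that r unfolding dead_def by blast
    qed
    then show ?thesis by (simp add: G_L)
  qed
  ultimately show ?thesis using W that by blast
qed

end

section \<open>Following the lighter node\<close>

lemma hamming_triangle:
  assumes "length a = length b" shows "hamming a c \<le> hamming a b + hamming b c"
proof -
  have "{i. i < length a \<and> a ! i \<noteq> c ! i} \<subseteq>
    {i. i < length a \<and> a ! i \<noteq> b ! i} \<union> {i. i < length b \<and> b ! i \<noteq> c ! i}"
    using assms by auto
  then have "hamming a c \<le> card ({i. i < length a \<and> a ! i \<noteq> b ! i} \<union> {i. i < length b \<and> b ! i \<noteq> c ! i})"
    unfolding hamming_def by (intro card_mono) auto
  also have "\<dots> \<le> hamming a b + hamming b c" unfolding hamming_def by (rule card_Un_le)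
  finally show ?thesis .
qed

lemma hamming_update: "hamming a (a[i := b]) \<le> 1"
proof -
  have "{m. m < length a \<and> a ! m \<noteq> a[i := b] ! m} \<subseteq> {i}" by (auto simp: nth_list_update split: if_splits) (metis nth_list_update_neq)+
  then have "hamming a (a[i := b]) \<le> card {i}" unfolding hamming_def by (intro card_mono) auto
  then show ?thesis by simp
qed

context read_once_bp
begin

lemma weight_le_1: "weight \<C> \<le> 1"
  unfolding weight_def by (intro prod_le_1) (simp add: one_le_power)

lemma sat_cong:
  assumes "\<And>p. p \<in> \<Union>\<C> \<Longrightarrow> a ! var P (fst p) = a' ! var P (fst p)" "sat a \<C>"
  shows "sat a' \<C>"
  unfolding sat_def
proof
  fix C assume C: "C \<in> \<C>"
  then obtain p where p: "p \<in> C" "a ! var P (fst p) \<noteq> snd p"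
    using assms(2) unfolding sat_def by fastforce
  moreover have "a ! var P (fst p) = a' ! var P (fst p)" using C p(1) by (intro assms(1)) blast
  ultimately have "a' ! var P (fst p) \<noteq> snd p" by simp
  with p(1) show "\<exists>(u, b)\<in>C. a' ! var P u \<noteq> b" by (intro bexI[of _ p]) (simp_all add: case_prod_unfold)
qed

lemma agrees_cong:
  assumes "\<And>p. p \<in> Q \<Longrightarrow> a ! var P (fst p) = a' ! var P (fst p)" "agrees a Q"
  shows "agrees a' Q"
  using assms unfolding agrees_def by fastforce

text \<open>By \<open>var_neq\<close> the changed variable is not queried at any node below the step
  that is redirected, so conditions on such nodes survive the change.\<close>

lemma redirect:
  assumes a: "a \<in> cube (nvars P)" and k: "k < depth P"
  obtains a' where "a' \<in> cube (nvars P)" "node_at P a' (Suc k) = succ P (node_at P a k) b"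
    "hamming a a' \<le> 1"
    "\<And>v. v \<in> nodes P - sinks P \<Longrightarrow> edge\<^sup>*\<^sup>* (node_at P a' (Suc k)) v \<Longrightarrow> a ! var P v = a' ! var P v"
proof
  let ?u = "node_at P a k"
  let ?a = "a[var P ?u := b]"
  show "?a \<in> cube (nvars P)" using a by (simp add: cube_def)
  show s: "node_at P ?a (Suc k) = succ P ?u b" by (rule node_at_update_Suc[OF a k])
  show "hamming a ?a \<le> 1" by (rule hamming_update)
  show "a ! var P v = ?a ! var P v"
    if "v \<in> nodes P - sinks P" "edge\<^sup>*\<^sup>* (node_at P ?a (Suc k)) v" for v
  proof -
    have "edge ?u (succ P ?u b)" using node_at_nonsink[OF k, of a] by (auto simp: edge_def)
    then have "edge\<^sup>+\<^sup>+ ?u v" using that(2) unfolding s by (rule rtranclp_into_tranclp2)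
    from var_neq[OF this that(1)] show ?thesis by simp
  qed
qed

end

locale two_nodes = bp_target P L T for P :: "'v bprog" and L T +
  fixes j :: nat and x y :: 'v
  assumes j_le: "j \<le> L" and G_j: "G j = {x, y}" "x \<noteq> y"
    and card_G: "\<And>i. j \<le> i \<Longrightarrow> i \<le> L \<Longrightarrow> card (G i) \<le> 2"
    and end_gt: "5 / 6 < sum (mass L) (G L)" and x_heavy: "mass j y \<le> mass j x"
begin

abbreviation N :: "nat \<Rightarrow> real" where
  "N i \<equiv> sum (mass i) (G i)"

lemma N_le: "i < L \<Longrightarrow> N (Suc i) \<le> N i"
  using sum_push_mono[of i "mass i"] mass_nonneg by (simp add: mass_Suc)

lemma N_gt: "i \<le> L \<Longrightarrow> 5 / 6 < N i"
proof (induction "L - i" arbitrary: i)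
  case 0
  then have "i = L" by simp
  then show ?case using end_gt by simp
next
  case (Suc k)
  then have "5 / 6 < N (Suc i)" "i < L" by simp_all
  then show ?case using N_le[of i] by simp
qed

text \<open>\<open>Q\<close> has one literal for each leak met on the way down from
  \<open>y\<close>, so whatever starts at \<open>y\<close> is halved \<open>card Q\<close> times.
  The last condition says this for any flow \<open>g\<close>, because it is applied to the share of
  the mass that passes through \<open>y\<close>. The bound by \<open>i - j\<close> lets a loss be
  charged to levels.\<close>

definition chain :: "nat \<Rightarrow> 'v \<Rightarrow> 'v \<Rightarrow> ('v \<times> bool) set \<Rightarrow> bool" where
  "chain i w v Q \<longleftrightarrow> G i = {w, v} \<and> w \<noteq> v \<and> N i / 2 \<le> mass i v \<and> finite Q \<and> chained Q
     \<and> (\<forall>p\<in>Q. edge\<^sup>*\<^sup>* y (fst p) \<and> edge\<^sup>+\<^sup>+ (fst p) w) \<and> edge\<^sup>*\<^sup>* y w \<and> card Q \<le> i - j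
     \<and> (\<forall>a. node_at P a j = x \<longrightarrow> node_at P a i = v)
     \<and> (\<forall>a. node_at P a j = y \<and> agrees a Q \<longrightarrow> node_at P a i = w)
     \<and> (\<forall>g. (\<forall>k\<ge>j. g (Suc k) = push (g k)) \<and> g j x = 0 \<longrightarrow> g i v = 0 \<and> g i w = g j y / 2 ^ card Q)"

text \<open>The common successor \<open>z\<close> must hold half of the mass in order to start a
  \<open>clause_run\<close> on the next level.\<close>

definition merges :: "nat \<Rightarrow> 'v \<Rightarrow> 'v \<Rightarrow> bool" where
  "merges i w v \<longleftrightarrow> i < L \<and> (\<exists>z\<in>G (Suc i). z \<in> range (succ P w) \<and> z \<in> range (succ P v)
     \<and> N (Suc i) / 2 \<le> mass (Suc i) z)"

text \<open>The heavy node \<open>v\<close> cannot leak. If it has two successors, they are all the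
  good nodes of the next level, so a good successor of \<open>w\<close> is shared and gets at least
  half of the mass of both. If it has one, then either \<open>w\<close> can move there too, or
  \<open>w\<close> has just one good successor of its own.\<close>

lemma chain_step:
  assumes i: "j \<le> i" "i < L" and C: "chain i w v Q"
  shows "merges i w v \<or> (\<exists>w' v' Q'. chain (Suc i) w' v' Q')"
proof -
  have G: "G i = {w, v}" "w \<noteq> v" and vN: "N i / 2 \<le> mass i v" and Q: "finite Q" "chained Q"
    and Qr: "\<And>p. p \<in> Q \<Longrightarrow> edge\<^sup>*\<^sup>* y (fst p) \<and> edge\<^sup>+\<^sup>+ (fst p) w" and yw: "edge\<^sup>*\<^sup>* y w"
    and cQ: "card Q \<le> i - j"
    and ax: "\<And>a. node_at P a j = x \<Longrightarrow> node_at P a i = v"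
    and ay: "\<And>a. node_at P a j = y \<Longrightarrow> agrees a Q \<Longrightarrow> node_at P a i = w"
    and fl: "\<And>g. (\<And>k. j \<le> k \<Longrightarrow> g (Suc k) = push (g k)) \<Longrightarrow> g j x = 0 \<Longrightarrow> g i v = 0 \<and> g i w = g j y / 2 ^ card Q"
    using C unfolding chain_def by blast+
  have vG: "v \<in> G i" "w \<in> G i" using G by simp_all
  have N1: "N i \<le> 1" by (rule sum_mass_le_1) (use i L_le in auto)
  have pushG: "push h z = (into w z * h w + into v z * h v) / 2" if "z \<in> G (Suc i)" for h z
    using push_G[OF that i(2), of h] G by (simp add: field_simps)
  have Ni: "N i = mass i w + mass i v" using G by simp
  have nn: "0 \<le> mass i w" "0 \<le> mass i v" by (rule mass_nonneg)+
  have vs: "succ P v b \<in> G (Suc i)" for b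
  proof (rule ccontr)
    assume "succ P v b \<notin> G (Suc i)"
    from sum_push_leak[of i "mass i", OF i(2) mass_nonneg vG(1) this] show False
      using N_gt[of "Suc i"] i(2) vN N1 by (simp add: mass_Suc)
  qed
  have G_eq: "G (Suc i) = {z, z'}" if "z \<in> G (Suc i)" "z' \<in> G (Suc i)" "z \<noteq> z'" for z z'
  proof (rule sym, rule card_seteq)
    show "card (G (Suc i)) \<le> card {z, z'}" using card_G[of "Suc i"] i that by simp
  qed (use that in auto)
  have one: "1 \<le> into u z" if "z \<in> range (succ P u)" for u z
  proof -
    obtain b where "z = succ P u b" using \<open>z \<in> range (succ P u)\<close> by blast
    then show ?thesis by (cases b) (auto simp: of_bool_def)
  qed
  obtain b where b: "succ P w b \<in> G (Suc i)" using G_succ[OF vG(2) i(2)] by blast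
  show ?thesis
  proof (cases "succ P v False = succ P v True")
    case False
    let ?z = "succ P w b"
    have "G (Suc i) = {succ P v False, succ P v True}" by (rule G_eq[OF vs vs False])
    then have zv: "?z \<in> range (succ P v)" using b by (metis insertE rangeI singletonD)
    have "mass (Suc i) ?z = (into w ?z * mass i w + into v ?z * mass i v) / 2"
      unfolding mass_Suc by (rule pushG[OF b])
    moreover have "mass i w \<le> into w ?z * mass i w" "mass i v \<le> into v ?z * mass i v"
      using mult_right_mono[OF one nn(1), of ?z w] mult_right_mono[OF one[OF zv] nn(2)] by simp_all
    ultimately have "N (Suc i) / 2 \<le> mass (Suc i) ?z" using N_le[OF i(2)] Ni by simp
    then have "merges i w v" unfolding merges_def using i(2) b zv by blast
    then show ?thesis ..
  next
    case True
    define v' where "v' = succ P v True"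
    have full: "succ P v b = v'" for b using True by (cases b) (simp_all add: v'_def)
    have v': "v' \<in> G (Suc i)" using vs by (simp add: v'_def)
    have mv: "mass (Suc i) v' = (into w v' * mass i w + 2 * mass i v) / 2"
      unfolding mass_Suc pushG[OF v'] by (simp add: full)
    have "0 \<le> into w v' * mass i w" using nn by simp
    then have "mass i v \<le> mass (Suc i) v'" using mv by simp
    moreover have "N (Suc i) / 2 \<le> N i / 2" using N_le[OF i(2)] by simp
    ultimately have vN': "N (Suc i) / 2 \<le> mass (Suc i) v'" using vN by (meson order_trans)
    show ?thesis
    proof (cases "v' \<in> range (succ P w)")
      case True
      then have "merges i w v" unfolding merges_def using i(2) v' vN' full by (auto intro!: bexI[of _ v'])
      then show ?thesis ..
    next
      case nv: False
      define w' where "w' = succ P w b"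
      have ne: "w' \<noteq> v'" using nv by (auto simp: w'_def)
      have w': "w' \<in> G (Suc i)" using b by (simp add: w'_def)
      have G': "G (Suc i) = {w', v'}" by (rule G_eq[OF w' v' ne])
      \<comment> \<open>As \<open>v'\<close> cannot be reached from \<open>w\<close> in one step, an
        edge of \<open>w\<close> that misses \<open>w'\<close> is a leak; exactly then an answer is
        prescribed.\<close>
      define Q' where "Q' = (if succ P w (\<not> b) = w' then Q else insert (w, b) Q)"
      have wns: "w \<in> nodes P - sinks P" by (rule G_nonsink[OF vG(2) i(2)])
      have e: "edge w w'" unfolding w'_def by (rule G_edge[OF vG(2) i(2)])
      have single: "chained {(w, b)}" using wns by (simp add: chained_def)
      have "chained (Q \<union> {(w, b)})" "Q \<inter> {(w, b)} = {}"
        using chained_Un[OF Q(2) single] Qr by auto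
      then have Q1: "chained Q'" and nin: "(w, b) \<notin> Q" using Q(2) by (auto simp: Q'_def)
      have Qr': "edge\<^sup>*\<^sup>* y (fst p) \<and> edge\<^sup>+\<^sup>+ (fst p) w'" if "p \<in> Q'" for p
      proof -
        have "p \<in> Q \<or> p = (w, b)" using that by (auto simp: Q'_def split: if_splits)
        then show ?thesis using Qr[of p] e yw by auto
      qed
      have into_w: "into w v' = 0" using nv by auto
      have into_v: "into v v' = 2" "into v w' = 0" using ne full by auto
      have "chain (Suc i) w' v' Q'"
        unfolding chain_def
      proof (intro conjI allI impI ballI)
        show "finite Q'" using Q by (simp add: Q'_def)
        show "edge\<^sup>*\<^sup>* y w'" using yw e by simp
        show "card Q' \<le> Suc i - j" using cQ Q(1) nin i(1) by (simp add: Q'_def Suc_diff_le)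
        show "node_at P a (Suc i) = v'" if "node_at P a j = x" for a
          using ax[OF that] full by simp
        show "node_at P a (Suc i) = w'" if *: "node_at P a j = y \<and> agrees a Q'" for a
        proof -
          have "agrees a Q" using * unfolding agrees_def Q'_def by (auto split: if_splits)
          with * have "node_at P a i = w" using ay by blast
          moreover have "succ P w (a ! var P w) = w'"
          proof (cases "succ P w (\<not> b) = w'")
            case True
            then show ?thesis unfolding w'_def by (cases "a ! var P w"; cases b) auto
          next
            case False
            then have "a ! var P w = b" using * unfolding agrees_def Q'_def by auto
            then show ?thesis by (simp add: w'_def)
          qed
          ultimately show ?thesis by simp
        qed
        fix g assume "(\<forall>k\<ge>j. g (Suc k) = push (g k)) \<and> g j x = (0::real)"
        then have g: "\<And>k. j \<le> k \<Longrightarrow> g (Suc k) = push (g k)" "g j x = 0" by simp_all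
        note gi = fl[OF g]
        show "g (Suc i) v' = 0" unfolding g(1)[OF i(1)] pushG[OF v'] into_w using gi by simp
        have gw: "g (Suc i) w' = into w w' * g i w / 2" unfolding g(1)[OF i(1)] pushG[OF w'] using gi by simp
        show "g (Suc i) w' = g j y / 2 ^ card Q'"
        proof (cases "succ P w (\<not> b) = w'")
          case True
          then have "into w w' = 2" unfolding w'_def by (cases b) auto
          with True gi gw show ?thesis by (simp add: Q'_def)
        next
          case False
          then have "into w w' = 1" unfolding w'_def by (cases b) auto
          with False gi gw Q(1) nin show ?thesis by (simp add: Q'_def)
        qed
      qed (use G' ne vN' Q1 Qr' in auto)
      then show ?thesis by blast
    qed
  qed
qed

lemma chain_start: "chain j y x {}"
proof -
  have "G j = {y, x}" using G_j by auto
  then show ?thesis unfolding chain_def using G_j x_heavy by (simp add: chained_def)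
qed

lemma chain_exists:
  obtains (merge) e w v Q where "j \<le> e" "chain e w v Q" "merges e w v"
  | (stop) w v Q where "chain L w v Q"
proof -
  have "(\<exists>e w v Q. j \<le> e \<and> chain e w v Q \<and> merges e w v) \<or> (\<exists>w v Q. chain i w v Q)"
    if "j \<le> i" "i \<le> L" for i
    using that
  proof (induction i rule: dec_induct)
    case base
    then show ?case using chain_start by blast
  next
    case (step i)
    then have "i < L" by simp
    with step show ?case using chain_step[of i] by (meson less_imp_le)
  qed
  from this[OF j_le order_refl] show ?thesis using merge stop by blast
qed

end

section \<open>Descending through the targets\<close>

locale narrow_bp = read_once_bp P for P :: "'v bprog" +
  assumes card_level: "\<And>k. card {v \<in> nodes P. level P v = k} \<le> 3"
begin

lemma level_0:
  assumes "v \<in> nodes P" "level P v = 0" shows "v = source P"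
proof -
  have "v \<in> {v \<in> nodes P. level P v = 0}" using assms by simp
  then show ?thesis unfolding first_level by simp
qed

definition accepting :: "'v set" where
  "accepting = {v \<in> sinks P. label P v}"

text \<open>A target found on the way is a single node, while the initial one, the accepting sinks,
  comes without clauses. So if two nodes \<open>w\<close> and \<open>v\<close> stay apart down to
  level \<open>L\<close>, then \<open>T\<close> has two elements and nothing below it remains to be
  satisfied.\<close>

definition target :: "nat \<Rightarrow> 'v set \<Rightarrow> ('v \<times> bool) set set \<Rightarrow> bool" where
  "target L T \<C> \<longleftrightarrow> L \<le> depth P \<and> T \<subseteq> nodes P \<and> (\<forall>t\<in>T. level P t = L) \<and> clauses \<C>
     \<and> (\<forall>t\<in>T. \<forall>p\<in>\<Union>\<C>. edge\<^sup>*\<^sup>* t (fst p)) \<and> (card T = 1 \<or> \<C> = {})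
     \<and> (\<forall>a \<in> cube (nvars P). node_at P a L \<in> T \<and> sat a \<C> \<longrightarrow> node_at P a (depth P) \<in> accepting)"

text \<open>This is the test handed to richness: \<open>Q\<close> holds prescribed answers, each
  clause a forbidden combination. The distance 2 counts one bit for entering the good nodes and one
  for merging.\<close>

definition reducible :: "real \<Rightarrow> real \<Rightarrow> bool" where
  "reducible e q \<longleftrightarrow> (\<exists>Q \<C>. finite Q \<and> chained (Q \<union> \<Union>\<C>) \<and> Q \<inter> \<Union>\<C> = {} \<and> clauses \<C>
     \<and> real (card Q) \<le> q \<and> e \<le> weight \<C>
     \<and> (\<forall>a \<in> cube (nvars P). agrees a Q \<and> sat a \<C> \<longrightarrow>
          (\<exists>a' \<in> cube (nvars P). hamming a a' \<le> 2 \<and> node_at P a' (depth P) \<in> accepting)))"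

text \<open>The clauses of the run lie strictly above the target and those of \<open>\<C>\<close> at
  or below it; hence they are disjoint and their weights multiply.\<close>

lemma target_extend:
  assumes "target L T \<C>" and "clause_run P L T l x f" and T: "T \<noteq> {}"
  obtains \<E> where "clauses \<E>" "\<And>p. p \<in> \<Union>\<E> \<Longrightarrow> edge\<^sup>*\<^sup>* x (fst p)"
    "sum (f L) T * weight \<C> \<le> sum (f l) (bp_target.G P T l) * weight \<E>"
    "\<And>a. a \<in> cube (nvars P) \<Longrightarrow> node_at P a l = x \<Longrightarrow> sat a \<E> \<Longrightarrow> node_at P a (depth P) \<in> accepting"
proof -
  interpret clause_run P L T l x f by (rule assms(2))
  have t: "clauses \<C>" "\<And>t p. t \<in> T \<Longrightarrow> p \<in> \<Union>\<C> \<Longrightarrow> edge\<^sup>*\<^sup>* t (fst p)"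
    and acc: "\<And>a. a \<in> cube (nvars P) \<Longrightarrow> node_at P a L \<in> T \<Longrightarrow> sat a \<C> \<Longrightarrow> node_at P a (depth P) \<in> accepting"
    using assms(1) unfolding target_def by blast+
  obtain \<D> where D: "clauses \<D>" "\<And>p. p \<in> \<Union>\<D> \<Longrightarrow> edge\<^sup>*\<^sup>* x (fst p)"
    "\<And>p t. p \<in> \<Union>\<D> \<Longrightarrow> t \<in> T \<Longrightarrow> edge\<^sup>+\<^sup>+ (fst p) t"
    "N L \<le> N l * weight \<D>"
    "\<And>a. a \<in> cube (nvars P) \<Longrightarrow> node_at P a l = x \<Longrightarrow> sat a \<D> \<Longrightarrow> node_at P a L \<in> T"
    using clauses_exist by blast
  obtain t where tT: "t \<in> T" "edge\<^sup>*\<^sup>* x t" using x_G unfolding G_def by blast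
  have sep: "edge\<^sup>+\<^sup>+ (fst p) (fst q)" if "p \<in> \<Union>\<D>" "q \<in> \<Union>\<C>" for p q
    using D(3)[OF that(1) tT(1)] t(2)[OF tT(1) that(2)] by (rule tranclp_rtranclp_tranclp)
  show ?thesis
  proof
    show "clauses (\<D> \<union> \<C>)" by (rule clauses_Un(1)[OF D(1) t(1) sep])
    show "edge\<^sup>*\<^sup>* x (fst p)" if p: "p \<in> \<Union>(\<D> \<union> \<C>)" for p
    proof -
      have "p \<in> \<Union>\<D> \<or> p \<in> \<Union>\<C>" using p by blast
      then show ?thesis using D(2) t(2)[OF tT(1)] tT(2) by (meson rtranclp_trans)
    qed
    have "sum (f L) T * weight \<C> \<le> (N l * weight \<D>) * weight \<C>"
      using D(4) weight_nonneg by (intro mult_right_mono) (simp_all add: G_L)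
    moreover have "weight (\<D> \<union> \<C>) = weight \<D> * weight \<C>" by (rule clauses_Un(2)[OF D(1) t(1) sep])
    ultimately show "sum (f L) T * weight \<C> \<le> N l * weight (\<D> \<union> \<C>)"
      by (simp only: mult.assoc)
    show "node_at P a (depth P) \<in> accepting"
      if "a \<in> cube (nvars P)" "node_at P a l = x" "sat a (\<D> \<union> \<C>)" for a
    proof (rule acc[OF that(1)])
      have s: "sat a \<D>" "sat a \<C>" using that(3) unfolding sat_def by blast+
      show "node_at P a L \<in> T" by (rule D(5)[OF that(1,2) s(1)])
      show "sat a \<C>" by (rule s(2))
    qed
  qed
qed

lemma reducibleI:
  assumes "finite Q" "chained (Q \<union> \<Union>\<C>)" "Q \<inter> \<Union>\<C> = {}" "clauses \<C>" "real (card Q) \<le> q" "e \<le> weight \<C>"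
    and "\<And>a. a \<in> cube (nvars P) \<Longrightarrow> agrees a Q \<Longrightarrow> sat a \<C> \<Longrightarrow>
      \<exists>a' \<in> cube (nvars P). hamming a a' \<le> 2 \<and> node_at P a' (depth P) \<in> accepting"
  shows "reducible e q"
  unfolding reducible_def using assms by blast

text \<open>\<open>\<kappa> * L\<close> is the loss still allowed. Replacing the target by a node of
  level \<open>j\<close>, after \<open>m\<close> literals, gives up at most
  \<open>1 / 2 ^ m \<le> \<kappa> * m\<close> of the mass and descends at least \<open>m\<close>
  levels. Charging levels makes it unnecessary to count the replacements.\<close>

lemma target_reducible:
  fixes e q \<kappa> :: real
  assumes e: "5 / 6 < e" and q: "0 \<le> q" and \<kappa>: "0 \<le> \<kappa>"
    and loss: "\<And>m::nat. q < m \<Longrightarrow> 1 / 2 ^ m \<le> \<kappa> * m"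
    and "target L T \<C>" "e + \<kappa> * L \<le> sum (mass L) T * weight \<C>"
  shows "reducible e q"
  using assms(5,6)
proof (induction L arbitrary: T \<C> rule: less_induct)
  case (less L)
  have t: "L \<le> depth P" "T \<subseteq> nodes P" "\<And>t. t \<in> T \<Longrightarrow> level P t = L" "clauses \<C>"
    "\<And>t p. t \<in> T \<Longrightarrow> p \<in> \<Union>\<C> \<Longrightarrow> edge\<^sup>*\<^sup>* t (fst p)" "card T = 1 \<or> \<C> = {}"
    and acc: "\<And>a. a \<in> cube (nvars P) \<Longrightarrow> node_at P a L \<in> T \<Longrightarrow> sat a \<C> \<Longrightarrow> node_at P a (depth P) \<in> accepting"
    using less.prems(1) unfolding target_def by blast+
  interpret bp_target P L T by unfold_locales (use t in auto)
  have finT: "finite T" using t(2) finite_nodes finite_subset by blast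
  have T1: "sum (mass L) T \<le> 1" by (rule sum_mass_le_1[OF t(1) finT])
  have T0: "0 \<le> sum (mass L) T" by (intro sum_nonneg mass_nonneg)
  have "0 \<le> \<kappa> * L" using \<kappa> by simp
  then have eW: "e \<le> sum (mass L) T * weight \<C>" using less.prems(2) by linarith
  have "sum (mass L) T * weight \<C> \<le> weight \<C>"
    using T1 weight_nonneg by (simp add: mult_left_le_one_le T0)
  then have ew: "e \<le> weight \<C>" using eW by linarith
  have "sum (mass L) T * weight \<C> \<le> sum (mass L) T"
    using T0 weight_le_1 by (simp add: mult_left_le)
  then have eT: "e \<le> sum (mass L) T" using eW by linarith
  have Tne: "T \<noteq> {}" using eT e by auto
  have ch: "chained (\<Union>\<C>)" using t(4) by (simp add: clauses_def)
  show ?case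
  proof (cases "\<forall>i\<le>L. \<forall>v\<in>nodes P. level P v = i \<longrightarrow> v \<in> G i")
    case True
    show ?thesis
    proof (rule reducibleI[of "{}" \<C>])
      fix a assume a: "a \<in> cube (nvars P)" "sat a \<C>"
      have "node_at P a L \<in> G L" using True node_at_level[OF t(1), of a] by blast
      then have "node_at P a (depth P) \<in> accepting" using acc[OF a(1) _ a(2)] by (simp add: G_L)
      moreover have "hamming a a \<le> 2" by (simp add: hamming_def)
      ultimately show "\<exists>a'\<in>cube (nvars P). hamming a a' \<le> 2 \<and> node_at P a' (depth P) \<in> accepting"
        using a(1) by blast
    qed (use t(4) ch q ew in auto)
  next
    case False
    define bad where "bad i \<longleftrightarrow> i \<le> L \<and> (\<exists>v\<in>nodes P. level P v = i \<and> v \<notin> G i)" for i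
    have ex: "\<exists>i. bad i" using False unfolding bad_def by blast
    define j where "j = (LEAST i. bad i)"
    have bj: "bad j" unfolding j_def by (rule LeastI_ex[OF ex])
    have jL: "j \<le> L" using bj by (simp add: bad_def)
    have least: "v \<in> G i" if "i < j" "v \<in> nodes P" "level P v = i" for i v
      using not_less_Least[of i bad, folded j_def] that jL unfolding bad_def by auto
    \<comment> \<open>Level 0 is the source alone, and it is good because \<open>T\<close> is not
      empty.\<close>
    have "j \<noteq> 0"
    proof
      assume "j = 0"
      obtain u where "u \<in> G 0" using G_nonempty[OF Tne, of 0] by auto
      moreover from this have "u = source P" using G_node[of u 0] level_0 by simp
      moreover obtain v where "v \<in> nodes P" "level P v = 0" "v \<notin> G 0"
        using bj unfolding bad_def \<open>j = 0\<close> by blast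
      moreover from this have "v = source P" using level_0 by simp
      ultimately show False by simp
    qed
    then obtain k where k: "j = Suc k" by (cases j) auto
    have kd: "k < depth P" "k < L" using k jL t(1) by simp_all
    \<comment> \<open>All successors of a bad node are bad, so from \<open>j\<close> on every level
      down to \<open>L\<close> has a bad node; this is why at most two good ones remain.\<close>
    have later: "bad i" if "j \<le> i" "i \<le> L" for i
      using that
    proof (induction i rule: dec_induct)
      case base
      show ?case by (rule bj)
    next
      case (step i)
      then obtain v where v: "v \<in> nodes P" "level P v = i" "v \<notin> G i" unfolding bad_def by auto
      have "v \<notin> sinks P" using nonsink_iff[OF v(1)] v(2) step t(1) by simp
      then have ed: "edge v (succ P v True)" using v(1) unfolding edge_def by blast
      then have "succ P v True \<notin> G (Suc i)" using G_pred v(3) by blast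
      moreover have "succ P v True \<in> nodes P" "level P (succ P v True) = Suc i"
        using edge_nodes[OF ed] edge_level[OF ed] v(2) by simp_all
      ultimately show ?case using step unfolding bad_def by auto
    qed
    have cG: "card (G i) \<le> 2" if "j \<le> i" "i \<le> L" for i
    proof -
      have "G i \<subset> {v \<in> nodes P. level P v = i}"
        using later[OF that] unfolding bad_def G_def by blast
      then have "card (G i) < card {v \<in> nodes P. level P v = i}"
        by (rule psubset_card_mono[rotated]) (simp add: finite_nodes)
      then show ?thesis using card_level[of i] by simp
    qed
    have Nj: "sum (mass i) (G i) \<le> 1" if "i \<le> L" for i
      by (rule sum_mass_le_1) (use that t(1) in auto)
    have run: "clause_run P L T l z mass"
      if "j \<le> l" "l \<le> L" "z \<in> G l" "sum (mass l) (G l) / 2 \<le> mass l z" for l z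
      by unfold_locales (use that cG mass_nonneg mass_Suc Nj eT e G_L in auto)
    have enter: "\<exists>a' \<in> cube (nvars P). node_at P a' j \<in> G j \<and> hamming a a' \<le> 1 \<and>
      (\<forall>v \<in> nodes P - sinks P. edge\<^sup>*\<^sup>* (node_at P a' j) v \<longrightarrow> a ! var P v = a' ! var P v)"
      if a: "a \<in> cube (nvars P)" for a
    proof -
      have "node_at P a k \<in> G k" using least[of k] node_at_level[of k a] kd k by simp
      from G_succ[OF this kd(2)] obtain b where b: "succ P (node_at P a k) b \<in> G (Suc k)" by blast
      from redirect[OF a kd(1), of b] b show ?thesis unfolding k by metis
    qed
    have lits: "fst p \<in> nodes P - sinks P" if "clauses \<E>" "p \<in> \<Union>\<E>" for \<E> p
      using that unfolding clauses_def chained_def by blast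
    have "G j \<noteq> {}" using G_nonempty[OF Tne jL] .
    then have "card (G j) \<noteq> 0" by simp
    with cG[OF order_refl jL] consider "card (G j) = 1" | "card (G j) = 2" by linarith
    then show ?thesis
    proof cases
      case 1
      then obtain x where x: "G j = {x}" by (auto simp: card_Suc_eq)
      have "clause_run P L T j x mass" by (rule run) (use x jL mass_nonneg in auto)
      from target_extend[OF less.prems(1) this Tne] obtain \<E> where E: "clauses \<E>"
        "\<And>p. p \<in> \<Union>\<E> \<Longrightarrow> edge\<^sup>*\<^sup>* x (fst p)"
        "sum (mass L) T * weight \<C> \<le> sum (mass j) (G j) * weight \<E>"
        "\<And>a. a \<in> cube (nvars P) \<Longrightarrow> node_at P a j = x \<Longrightarrow> sat a \<E> \<Longrightarrow> node_at P a (depth P) \<in> accepting"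
        by blast
      have "sum (mass j) (G j) * weight \<E> \<le> weight \<E>"
        using Nj[OF jL] weight_nonneg by (simp add: mult_left_le_one_le sum_nonneg mass_nonneg)
      then have eE: "e \<le> weight \<E>" using E(3) eW by linarith
      show ?thesis
      proof (rule reducibleI[of "{}" \<E>])
        fix a assume a: "a \<in> cube (nvars P)" "sat a \<E>"
        from enter[OF a(1)] obtain a' where a': "a' \<in> cube (nvars P)" "node_at P a' j = x" "hamming a a' \<le> 1"
          "\<And>v. v \<in> nodes P - sinks P \<Longrightarrow> edge\<^sup>*\<^sup>* x v \<Longrightarrow> a ! var P v = a' ! var P v"
          unfolding x by auto
        have "sat a' \<E>" by (rule sat_cong[OF a'(4)[OF lits[OF E(1)] E(2)] a(2)])
        from E(4)[OF a'(1,2) this] show "\<exists>a'\<in>cube (nvars P). hamming a a' \<le> 2 \<and> node_at P a' (depth P) \<in> accepting"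
          using a'(1,3) by (intro bexI[of _ a']) auto
      qed (use E(1) q eE in \<open>auto simp: clauses_def\<close>)
    next
      case 2
      then obtain x0 y0 where xy0: "G j = {x0, y0}" "x0 \<noteq> y0" by (auto simp: card_2_iff)
      have "\<exists>x y. G j = {x, y} \<and> x \<noteq> y \<and> mass j y \<le> mass j x"
      proof (cases "mass j y0 \<le> mass j x0")
        case True
        then show ?thesis using xy0 by blast
      next
        case False
        then show ?thesis using xy0 by (intro exI[of _ y0] exI[of _ x0]) auto
      qed
      then obtain x y where xy: "G j = {x, y}" "x \<noteq> y" "mass j y \<le> mass j x" by blast
      interpret two_nodes P L T j x y
        by unfold_locales (use jL xy cG eT e G_L in auto)
      have narrow_case: "reducible e q \<or> real (card Q) > q"
        if je: "j \<le> i" and C: "chain i w v Q" and M: "merges i w v" for i w v Q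
      proof (cases "real (card Q) \<le> q")
        case cQ: True
        have iL: "i < L" using M by (simp add: merges_def)
        obtain z where z: "z \<in> G (Suc i)" "z \<in> range (succ P w)" "z \<in> range (succ P v)"
          "N (Suc i) / 2 \<le> mass (Suc i) z" using M unfolding merges_def by blast
        have G: "G i = {w, v}" and Q: "finite Q" "chained Q"
          and Qr: "\<And>p. p \<in> Q \<Longrightarrow> edge\<^sup>*\<^sup>* y (fst p) \<and> edge\<^sup>+\<^sup>+ (fst p) w"
          and ax: "\<And>a. node_at P a j = x \<Longrightarrow> node_at P a i = v"
          and ay: "\<And>a. node_at P a j = y \<Longrightarrow> agrees a Q \<Longrightarrow> node_at P a i = w"
          using C unfolding chain_def by blast+
        have ed: "edge w z" using z(2) G_edge[of w i] G iL by auto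
        have "clause_run P L T (Suc i) z mass" by (rule run) (use z je iL in auto)
        from target_extend[OF less.prems(1) this Tne] obtain \<E> where E: "clauses \<E>"
          "\<And>p. p \<in> \<Union>\<E> \<Longrightarrow> edge\<^sup>*\<^sup>* z (fst p)"
          "sum (mass L) T * weight \<C> \<le> N (Suc i) * weight \<E>"
          "\<And>a. a \<in> cube (nvars P) \<Longrightarrow> node_at P a (Suc i) = z \<Longrightarrow> sat a \<E> \<Longrightarrow> node_at P a (depth P) \<in> accepting"
          by blast
        have "N (Suc i) * weight \<E> \<le> weight \<E>"
          using Nj[of "Suc i"] iL weight_nonneg by (simp add: mult_left_le_one_le sum_nonneg mass_nonneg)
        then have eE: "e \<le> weight \<E>" using E(3) eW by linarith
        have sep: "edge\<^sup>+\<^sup>+ (fst p) (fst q)" if "p \<in> Q" "q \<in> \<Union>\<E>" for p q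
        proof -
          have "edge\<^sup>+\<^sup>+ (fst p) z" using Qr[OF that(1)] ed by (meson tranclp.trancl_into_trancl)
          then show ?thesis using E(2)[OF that(2)] by (rule tranclp_rtranclp_tranclp)
        qed
        have chE: "chained (\<Union>\<E>)" using E(1) by (simp add: clauses_def)
        have "reducible e q"
        proof (rule reducibleI[of Q \<E>])
          show "chained (Q \<union> \<Union>\<E>)" "Q \<inter> \<Union>\<E> = {}" by (rule chained_Un[OF Q(2) chE sep]; assumption)+
          fix a assume a: "a \<in> cube (nvars P)" "agrees a Q" "sat a \<E>"
          from enter[OF a(1)] obtain a1 where a1: "a1 \<in> cube (nvars P)" "node_at P a1 j \<in> G j" "hamming a a1 \<le> 1"
            "\<And>v. v \<in> nodes P - sinks P \<Longrightarrow> edge\<^sup>*\<^sup>* (node_at P a1 j) v \<Longrightarrow> a ! var P v = a1 ! var P v"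
            by blast
          have id: "i < depth P" using iL t(1) by simp
          have a1i: "node_at P a1 i \<in> {w, v}"
          proof (cases "node_at P a1 j = x")
            case True
            then show ?thesis using ax by simp
          next
            case False
            then have y: "node_at P a1 j = y" using a1(2) xy by simp
            have "a ! var P (fst p) = a1 ! var P (fst p)" if "p \<in> Q" for p
              by (rule a1(4)) (use Qr[OF that] Q(2) that y in \<open>auto simp: chained_def\<close>)
            from agrees_cong[OF this a(2)] show ?thesis using ay[OF y] by simp
          qed
          obtain b where b: "succ P (node_at P a1 i) b = z" using a1i z(2,3) by auto
          obtain a2 where a2: "a2 \<in> cube (nvars P)" "node_at P a2 (Suc i) = z" "hamming a1 a2 \<le> 1"
            "\<And>v. v \<in> nodes P - sinks P \<Longrightarrow> edge\<^sup>*\<^sup>* z v \<Longrightarrow> a1 ! var P v = a2 ! var P v"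
            using redirect[OF a1(1) id, of b] unfolding b by metis
          have "edge (node_at P a1 i) z" using node_at_nonsink[OF id, of a1] b unfolding edge_def by blast
          \<comment> \<open>The literals of \<open>\<E>\<close> lie below \<open>z\<close>, hence
            below the node entered at level \<open>j\<close>, so the first changed bit does not
            touch them either.\<close>
          then have rz: "edge\<^sup>*\<^sup>* (node_at P a1 j) z"
            using node_at_reach[OF je, of a1] id by simp
          have "sat a2 \<E>"
          proof (rule sat_cong[OF _ a(3)])
            fix p assume p: "p \<in> \<Union>\<E>"
            have "a ! var P (fst p) = a1 ! var P (fst p)"
              by (rule a1(4)[OF lits[OF E(1) p]]) (use rz E(2)[OF p] in \<open>rule rtranclp_trans\<close>)
            also have "\<dots> = a2 ! var P (fst p)" by (rule a2(4)[OF lits[OF E(1) p] E(2)[OF p]])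
            finally show "a ! var P (fst p) = a2 ! var P (fst p)" .
          qed
          from E(4)[OF a2(1,2) this] have "node_at P a2 (depth P) \<in> accepting" .
          moreover have "hamming a a2 \<le> 2"
            using hamming_triangle[of a a1 a2] a(1) a1(1,3) a2(3) by (simp add: cube_def)
          ultimately show "\<exists>a'\<in>cube (nvars P). hamming a a' \<le> 2 \<and> node_at P a' (depth P) \<in> accepting"
            using a2(1) by blast
        qed (use Q(1) E(1) cQ eE in auto)
        then show ?thesis ..
      qed simp
      have wide_case: "reducible e q" if je: "j \<le> i" "i \<le> L" and C: "chain i w v Q" and cQ: "q < card Q" for i w v Q
      proof -
        have G: "G i = {w, v}" "w \<noteq> v" and cQi: "card Q \<le> i - j"
          and fl: "\<And>g. (\<And>k. j \<le> k \<Longrightarrow> g (Suc k) = push (g k)) \<Longrightarrow> g j x = 0 \<Longrightarrow> g i v = 0 \<and> g i w = g j y / 2 ^ card Q"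
          using C unfolding chain_def by blast+
        \<comment> \<open>The share of the mass that passes through \<open>u\<close> at level
          \<open>j\<close>; it is meaningful only for \<open>k \<ge> j\<close>, as
          \<open>k - j\<close> is 0 before.\<close>
        define flow where "flow u k = (push ^^ (k - j)) (\<lambda>v. if v = u then mass j u else 0)" for u k
        have flow_j: "flow u j v = (if v = u then mass j u else 0)" for u v by (simp add: flow_def)
        have flow_Suc: "flow u (Suc k) = push (flow u k)" if "j \<le> k" for u k
          using that by (simp add: flow_def Suc_diff_le)
        have flow_nonneg: "0 \<le> flow u k v" for u k v
        proof -
          have "0 \<le> (push ^^ m) (\<lambda>v. if v = u then mass j u else 0) v" for m
            by (induction m arbitrary: v) (auto simp: mass_nonneg push_nonneg)
          then show ?thesis by (simp add: flow_def)
        qed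
        have split: "mass k u = flow x k u + flow y k u" if "j \<le> k" "k \<le> L" "u \<in> G k" for k u
          using that
        proof (induction k arbitrary: u rule: dec_induct)
          case base
          then show ?case using xy(1,2) by (auto simp: flow_j)
        next
          case (step k)
          then have kL: "k < L" by simp
          have "mass (Suc k) u = (\<Sum>v\<in>G k. into v u * mass k v / 2)"
            unfolding mass_Suc by (rule push_G[OF step.prems(2) kL])
          also have "\<dots> = (\<Sum>v\<in>G k. into v u * flow x k v / 2 + into v u * flow y k v / 2)"
            using step.IH kL by (intro sum.cong refl) (simp add: algebra_simps add_divide_distrib)
          also have "\<dots> = flow x (Suc k) u + flow y (Suc k) u"
            unfolding flow_Suc[OF step.hyps(1)] push_G[OF step.prems(2) kL] by (rule sum.distrib)
          finally show ?case .
        qed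
        have "sum (flow y k) (G k) \<le> sum (flow y i) (G i)" if "i \<le> k" "k \<le> L" for k
          using that
        proof (induction k rule: dec_induct)
          case (step k)
          then have "sum (flow y (Suc k)) (G (Suc k)) \<le> sum (flow y k) (G k)"
            using sum_push_mono[of k "flow y k"] flow_nonneg flow_Suc[of k y] je by simp
          with step show ?case by simp
        qed simp
        from this[OF je(2) order_refl] have "sum (flow y L) T \<le> sum (flow y i) (G i)" by (simp add: G_L)
        also have "\<dots> = mass j y / 2 ^ card Q"
          using fl[of "flow y", OF flow_Suc] xy(2) G by (simp add: flow_j)
        also have "\<dots> \<le> 1 / 2 ^ card Q"
        proof (intro divide_right_mono)
          show "mass j y \<le> 1" using sum_mass_le_1[of j "{y}"] jL t(1) by simp
        qed simp
        also have "\<dots> \<le> \<kappa> * card Q" by (rule loss[OF cQ])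
        also have "\<dots> \<le> \<kappa> * (real L - real j)"
          using cQi je \<kappa> by (intro mult_left_mono) linarith+
        finally have fy: "sum (flow y L) T \<le> \<kappa> * L - \<kappa> * j" by (simp add: algebra_simps)
        have "sum (mass L) T = (\<Sum>u\<in>T. flow x L u + flow y L u)"
          by (rule sum.cong) (use split[OF jL order_refl] G_L in auto)
        then have fT: "sum (mass L) T = sum (flow x L) T + sum (flow y L) T" by (simp add: sum.distrib)
        have fx: "e + \<kappa> * j \<le> sum (flow x L) T"
          using fT fy less.prems(2) \<open>sum (mass L) T * weight \<C> \<le> sum (mass L) T\<close> by linarith
        have "0 \<le> \<kappa> * j" using \<kappa> by simp
        then have gt: "5 / 6 < sum (flow x L) T" using fx e by linarith
        have sx: "sum (flow x j) (G j) = mass j x" using xy by (simp add: flow_j)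
        \<comment> \<open>Even without the mass through \<open>y\<close>, more than 5/6 arrives at
          \<open>T\<close>, so the run can be made for the flow of \<open>x\<close> alone.\<close>
        have "clause_run P L T j x (flow x)"
        proof
          show "sum (flow x j) (G j) \<le> 1" unfolding sx using sum_mass_le_1[of j "{x}"] jL t(1) by simp
          show "sum (flow x j) (G j) / 2 \<le> flow x j x" unfolding sx using mass_nonneg[of j x] by (simp add: flow_j)
        qed (use jL xy cG flow_nonneg flow_Suc gt G_L in auto)
        from target_extend[OF less.prems(1) this Tne] obtain \<E> where E: "clauses \<E>"
          "\<And>p. p \<in> \<Union>\<E> \<Longrightarrow> edge\<^sup>*\<^sup>* x (fst p)"
          "sum (flow x L) T * weight \<C> \<le> sum (flow x j) (G j) * weight \<E>"
          "\<And>a. a \<in> cube (nvars P) \<Longrightarrow> node_at P a j = x \<Longrightarrow> sat a \<E> \<Longrightarrow> node_at P a (depth P) \<in> accepting"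
          by blast
        have xG: "x \<in> G j" using xy by simp
        have tgt: "target j {x} \<E>"
          unfolding target_def using E(1,2,4) G_node[OF xG] jL t(1) by auto
        have "sum (mass L) T * weight \<C> = sum (flow x L) T * weight \<C> + sum (flow y L) T * weight \<C>"
          by (simp add: fT distrib_right)
        also have "\<dots> \<le> mass j x * weight \<E> + (\<kappa> * L - \<kappa> * j)"
        proof (rule add_mono)
          show "sum (flow x L) T * weight \<C> \<le> mass j x * weight \<E>" using E(3) by (simp add: sx)
          have "sum (flow y L) T * weight \<C> \<le> sum (flow y L) T"
            using weight_le_1 by (simp add: mult_left_le sum_nonneg flow_nonneg)
          then show "sum (flow y L) T * weight \<C> \<le> \<kappa> * L - \<kappa> * j" using fy by linarith
        qed
        finally have "e + \<kappa> * j \<le> mass j x * weight \<E>" using less.prems(2) by linarith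
        then have "e + \<kappa> * j \<le> sum (mass j) {x} * weight \<E>" by simp
        \<comment> \<open>The level really drops: \<open>Q\<close> has more than
          \<open>q \<ge> 0\<close> literals, at most one per level between \<open>j\<close> and
          \<open>i\<close>.\<close>
        moreover have "j < L" using cQ q cQi je by linarith
        ultimately show ?thesis using less.IH[OF _ tgt] by blast
      qed
      show ?thesis
      proof (rule chain_exists)
        fix i w v Q assume *: "j \<le> i" "chain i w v Q" "merges i w v"
        then have "i \<le> L" by (simp add: merges_def)
        then show ?thesis using narrow_case[OF *] wide_case[OF *(1) _ *(2)] by blast
      next
        fix w v Q assume C: "chain L w v Q"
        show ?thesis
        proof (cases "real (card Q) \<le> q")
          case True
          have G: "G L = {w, v}" "w \<noteq> v" and Q: "finite Q" "chained Q"
            and Qr: "\<And>p. p \<in> Q \<Longrightarrow> edge\<^sup>*\<^sup>* y (fst p) \<and> edge\<^sup>+\<^sup>+ (fst p) w"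
            and ax: "\<And>a. node_at P a j = x \<Longrightarrow> node_at P a L = v"
            and ay: "\<And>a. node_at P a j = y \<Longrightarrow> agrees a Q \<Longrightarrow> node_at P a L = w"
            using C unfolding chain_def by blast+
          have "card T = 2" using G by (simp add: G_L)
          then have C0: "\<C> = {}" using t(6) by simp
          show ?thesis
          proof (rule reducibleI[of Q "{}"])
            fix a assume a: "a \<in> cube (nvars P)" "agrees a Q"
            from enter[OF a(1)] obtain a1 where a1: "a1 \<in> cube (nvars P)" "node_at P a1 j \<in> G j" "hamming a a1 \<le> 1"
              "\<And>v. v \<in> nodes P - sinks P \<Longrightarrow> edge\<^sup>*\<^sup>* (node_at P a1 j) v \<Longrightarrow> a ! var P v = a1 ! var P v"
              by blast
            have "node_at P a1 L \<in> {w, v}"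
            proof (cases "node_at P a1 j = x")
              case True
              then show ?thesis using ax by simp
            next
              case False
              then have y: "node_at P a1 j = y" using a1(2) xy by simp
              have "a ! var P (fst p) = a1 ! var P (fst p)" if "p \<in> Q" for p
                by (rule a1(4)) (use Qr[OF that] Q(2) that y in \<open>auto simp: chained_def\<close>)
              from agrees_cong[OF this a(2)] show ?thesis using ay[OF y] by simp
            qed
            then have "node_at P a1 (depth P) \<in> accepting"
              using acc[OF a1(1)] G by (simp add: G_L C0 sat_def)
            then show "\<exists>a'\<in>cube (nvars P). hamming a a' \<le> 2 \<and> node_at P a' (depth P) \<in> accepting"
              using a1(1,3) by (intro bexI[of _ a1]) auto
          qed (use Q True ew C0 t(4) in auto)
        next
          case False
          then show ?thesis using wide_case[OF jL order_refl C] by simp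
        qed
      qed
    qed
  qed
qed

end

section \<open>Rich sets\<close>

text \<open>Bernoulli's inequality bounds powers from below; applied to \<open>(1 + z) ^ m\<close>
  it yields an upper bound on \<open>(1 - z) ^ m\<close>, because the product of the two powers is
  at most 1.\<close>

lemma one_minus_power_le:
  fixes z :: real
  assumes "0 \<le> z" "z \<le> 1"
  shows "(1 - z) ^ m * (1 + m * z) \<le> 1"
proof -
  have "1 + m * z \<le> (1 + z) ^ m" using Bernoulli_inequality[of z m] assms by simp
  then have "(1 - z) ^ m * (1 + m * z) \<le> (1 - z) ^ m * (1 + z) ^ m"
    using assms by (intro mult_left_mono) auto
  also have "\<dots> = (1 - z\<^sup>2) ^ m" by (simp add: power_mult_distrib[symmetric] power2_eq_square algebra_simps)
  also have "\<dots> \<le> 1" using assms by (intro power_le_one) (auto simp: power_le_one)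
  finally show ?thesis .
qed

text \<open>The exponent 11 is the least possible here: at \<open>m = 1\<close>, \<open>(15 / 16) ^ 11 < 1 / 2 < (15 / 16) ^ 10\<close>.\<close>
lemma clause_factor:
  assumes "1 \<le> m" shows "(1 - 1 / 2 ^ (m + 3)) ^ 11 \<le> 1 - 1 / (2::real) ^ m"
proof (cases "m = 1")
  case True
  then show ?thesis by (simp add: power_divide)
next
  case False
  define z :: real where "z = 1 / 2 ^ (m + 3)"
  have "(2::real) ^ 5 \<le> 2 ^ (m + 3)" using assms False by (intro power_increasing) auto
  then have z: "0 \<le> z" "z \<le> 1 / 32" unfolding z_def by (auto intro: divide_left_mono simp: field_simps)
  have "(1 - z) ^ 11 * (1 + 11 * z) \<le> 1" using one_minus_power_le[of z 11] z by simp
  \<comment> \<open>The product is \<open>1 + z * (3 - 88 * z)\<close>, so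
    \<open>z \<le> 3 / 88\<close> is needed; 1/32 meets this, whereas the value 1/16 at
    \<open>m = 1\<close> does not.\<close>
  also have "1 \<le> (1 - 8 * z) * (1 + 11 * z)"
  proof -
    have "0 \<le> z * (3 - 88 * z)" using z by (intro mult_nonneg_nonneg) auto
    then show ?thesis by (simp add: algebra_simps)
  qed
  finally have "(1 - z) ^ 11 \<le> 1 - 8 * z" using z by (simp add: mult_le_cancel_right)
  moreover have "8 * z = 1 / 2 ^ m" by (simp add: z_def power_add)
  ultimately show ?thesis by (simp add: z_def)
qed

context narrow_bp
begin

lemma accept_mass:
  "sum (mass (depth P)) accepting = card {a \<in> cube (nvars P). eval_bp P a} / 2 ^ nvars P"
proof -
  have "finite accepting" using finite_nodes sinks_subset by (auto simp: accepting_def intro: finite_subset)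
  moreover have "node_at P a (depth P) \<in> accepting \<longleftrightarrow> eval_bp P a" for a
    using node_at_level[of "depth P" a] sinks_iff
    by (auto simp: accepting_def eval_bp_def steps_eq_depth)
  ultimately show ?thesis by (simp add: sum_mass)
qed

lemma reducible_hit:
  assumes "reducible e (log 2 (nvars P))" "0 \<le> e" "\<eta> \<le> e ^ 11"
    and rich: "\<And>I \<R> Q c. c \<in> cube (nvars P) \<Longrightarrow> I \<subseteq> {..<nvars P} \<Longrightarrow> partition_on I \<R> \<Longrightarrow>
      \<eta> \<le> (\<Prod>R\<in>\<R>. 1 - 1 / 2 ^ card R) \<Longrightarrow> Q \<subseteq> {..<nvars P} - I \<Longrightarrow> card Q \<le> log 2 (nvars P) \<Longrightarrow>
      \<exists>a \<in> A \<inter> cube (nvars P). (\<forall>i\<in>Q. a ! i = c ! i) \<and> (\<forall>R\<in>\<R>. \<exists>i\<in>R. a ! i \<noteq> c ! i)"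
  shows "\<exists>a \<in> Omega_set 3 A \<inter> cube (nvars P). eval_bp P a"
proof -
  from assms(1) obtain Q \<C> where Q: "finite Q" "chained (Q \<union> \<Union>\<C>)" "Q \<inter> \<Union>\<C> = {}"
    and C: "clauses \<C>" and cQ: "card Q \<le> log 2 (nvars P)" and w: "e \<le> weight \<C>"
    and hit: "\<And>a. a \<in> cube (nvars P) \<Longrightarrow> agrees a Q \<Longrightarrow> sat a \<C> \<Longrightarrow>
      \<exists>a' \<in> cube (nvars P). hamming a a' \<le> 2 \<and> node_at P a' (depth P) \<in> accepting"
    unfolding reducible_def by blast
  define V :: "'v \<times> bool \<Rightarrow> nat" where "V p = var P (fst p)" for p
  define X where "X = Q \<union> \<Union>\<C>"
  \<comment> \<open>One word encodes the whole test: agreeing with \<open>c\<close> on the variables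
    of \<open>Q\<close> gives the prescribed answers, and differing from \<open>c\<close> somewhere
    in a block satisfies its clause. No variable gets two values since \<open>V\<close> is injective
    on \<open>X\<close>; variables outside are set to \<open>False\<close>.\<close>
  define c where "c = map (\<lambda>i. \<exists>p\<in>X. V p = i \<and> snd p) [0..<nvars P]"
  have inj: "inj_on V X" using chained_inj[OF Q(2)] by (simp add: V_def X_def inj_on_def)
  have V_less: "V p < nvars P" if "p \<in> X" for p
    using Q(2) that var_less unfolding chained_def X_def V_def by blast
  have cV: "c ! V p = snd p" if p: "p \<in> X" for p
  proof -
    have "c ! V p = (\<exists>p'\<in>X. V p' = V p \<and> snd p')" using V_less[OF p] by (simp add: c_def)
    also have "\<dots> = snd p" using inj_onD[OF inj _ _ p] p by blast
    finally show ?thesis .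
  qed
  let ?\<R> = "(`) V ` \<C>"
  have fin: "finite \<C>" "{} \<notin> \<C>" "disjoint \<C>" "finite (\<Union>\<C>)" using C by (simp_all add: clauses_def)
  have injC: "inj_on V (\<Union>\<C>)" by (rule inj_on_subset[OF inj]) (simp add: X_def)
  have part: "partition_on (V ` \<Union>\<C>) ?\<R>"
    unfolding partition_on_def
  proof (intro conjI)
    show "disjoint ?\<R>" using injC fin(3) by (rule disjoint_image)
  qed (use fin(2) in auto)
  have "\<eta> \<le> (\<Prod>C\<in>\<C>. 1 - 1 / 2 ^ card C)"
  proof -
    have "e ^ 11 \<le> weight \<C> ^ 11" using w assms(2) by (rule power_mono)
    also have "\<dots> = (\<Prod>C\<in>\<C>. (1 - 1 / 2 ^ (card C + 3)) ^ 11)" by (simp add: weight_def prod_power_distrib)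
    also have "\<dots> \<le> (\<Prod>C\<in>\<C>. 1 - 1 / 2 ^ card C)"
    proof (rule prod_mono, intro conjI)
      fix D assume D: "D \<in> \<C>"
      have "finite D" using fin(4) D by (rule finite_subset[OF Union_upper, rotated])
      moreover have "D \<noteq> {}" using D fin(2) by blast
      ultimately have "1 \<le> card D" by (simp add: Suc_le_eq card_gt_0_iff)
      then show "(1 - 1 / 2 ^ (card D + 3)) ^ 11 \<le> 1 - 1 / (2::real) ^ card D" by (rule clause_factor)
      have "(1::real) \<le> 2 ^ (card D + 3)" by (rule one_le_power) simp
      then show "0 \<le> (1 - 1 / (2::real) ^ (card D + 3)) ^ 11" by simp
    qed
    finally show ?thesis using assms(3) by linarith
  qed
  also have "\<dots> = (\<Prod>R\<in>?\<R>. 1 - 1 / 2 ^ card R)"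
  proof -
    have "inj_on ((`) V) \<C>" by (rule inj_on_image[OF injC])
    moreover have "card (V ` D) = card D" if "D \<in> \<C>" for D
      using that by (intro card_image inj_on_subset[OF injC]) blast
    ultimately show ?thesis by (simp add: prod.reindex)
  qed
  finally have \<eta>: "\<eta> \<le> (\<Prod>R\<in>?\<R>. 1 - 1 / 2 ^ card R)" .
  have "V ` Q \<inter> V ` \<Union>\<C> = V ` (Q \<inter> \<Union>\<C>)"
    by (rule inj_on_image_Int[OF inj, symmetric]) (auto simp: X_def)
  then have VQ: "V ` Q \<subseteq> {..<nvars P} - V ` \<Union>\<C>" using Q(3) V_less by (auto simp: X_def)
  have cVQ: "real (card (V ` Q)) \<le> log 2 (nvars P)" using card_image_le[OF Q(1), of V] cQ by linarith
  have sub: "V ` \<Union>\<C> \<subseteq> {..<nvars P}" using V_less by (auto simp: X_def)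
  have "c \<in> cube (nvars P)" by (simp add: c_def cube_def)
  from rich[OF this sub part \<eta> VQ cVQ] obtain a where a: "a \<in> A \<inter> cube (nvars P)"
    and aQ: "\<forall>i\<in>V ` Q. a ! i = c ! i" and aC: "\<forall>R\<in>?\<R>. \<exists>i\<in>R. a ! i \<noteq> c ! i"
    by (elim bexE conjE)
  have "agrees a Q"
    unfolding agrees_def
  proof (rule ballI)
    fix p assume p: "p \<in> Q"
    have "a ! V p = snd p" using aQ cV[of p] p by (simp add: X_def)
    then show "case p of (u, b) \<Rightarrow> a ! var P u = b" by (simp add: V_def case_prod_unfold)
  qed
  moreover have "sat a \<C>"
    unfolding sat_def
  proof
    fix D assume D: "D \<in> \<C>"
    then have "\<exists>i\<in>V ` D. a ! i \<noteq> c ! i" using aC by simp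
    then obtain p where p: "p \<in> D" "a ! V p \<noteq> c ! V p" by blast
    moreover have "p \<in> X" using p D by (auto simp: X_def)
    ultimately show "\<exists>(u, b)\<in>D. a ! var P u \<noteq> b"
      using cV[of p] by (intro bexI[of _ p]) (simp_all add: V_def case_prod_unfold)
  qed
  ultimately obtain a' where a': "a' \<in> cube (nvars P)" "hamming a a' \<le> 2"
    "node_at P a' (depth P) \<in> accepting" using hit a by (meson IntD2)
  have "a' \<in> Omega_set 3 A"
    unfolding Omega_set_def Omega_def using a a'(1,2) by (intro UN_I[of a]) (auto simp: cube_def)
  moreover have "eval_bp P a'" using a'(3) by (simp add: accepting_def eval_bp_def steps_eq_depth)
  ultimately show ?thesis using a'(1) by blast
qed

lemma hit_if_rich:
  assumes \<epsilon>: "\<epsilon> \<le> card {a \<in> cube (nvars P). eval_bp P a} / 2 ^ nvars P"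
    and e: "5 / 6 < e" "\<eta> \<le> e ^ 11" and n: "2 \<le> nvars P" "e + 1 / log 2 (nvars P) \<le> \<epsilon>"
    and rich: "\<And>I \<R> Q c. c \<in> cube (nvars P) \<Longrightarrow> I \<subseteq> {..<nvars P} \<Longrightarrow> partition_on I \<R> \<Longrightarrow>
      \<eta> \<le> (\<Prod>R\<in>\<R>. 1 - 1 / 2 ^ card R) \<Longrightarrow> Q \<subseteq> {..<nvars P} - I \<Longrightarrow> card Q \<le> log 2 (nvars P) \<Longrightarrow>
      \<exists>a \<in> A \<inter> cube (nvars P). (\<forall>i\<in>Q. a ! i = c ! i) \<and> (\<forall>R\<in>\<R>. \<exists>i\<in>R. a ! i \<noteq> c ! i)"
  shows "\<exists>a \<in> Omega_set 3 A \<inter> cube (nvars P). eval_bp P a"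
proof (rule reducible_hit[OF _ _ e(2) rich])
  let ?n = "real (nvars P)"
  \<comment> \<open>For \<open>m > log 2 ?n\<close> this gives \<open>1 / 2 ^ m \<le> 1 / ?n =
    \<kappa> * log 2 ?n \<le> \<kappa> * m\<close>, and at most \<open>nvars P\<close> levels cost
    \<open>1 / log 2 ?n\<close> in total.\<close>
  define \<kappa> where "\<kappa> = 1 / (?n * log 2 ?n)"
  have l: "1 \<le> log 2 ?n" using n(1) by (simp add: le_log_iff)
  have \<kappa>: "0 \<le> \<kappa>" using l by (simp add: \<kappa>_def)
  show "reducible e (log 2 (nvars P))"
  proof (rule target_reducible[OF e(1) _ \<kappa>])
    show "0 \<le> log 2 ?n" using l by simp
    show "1 / 2 ^ m \<le> \<kappa> * m" if m: "log 2 ?n < m" for m :: nat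
    proof -
      have "?n < 2 powr m" using m n(1) by (simp add: log_less_iff)
      then have "?n < 2 ^ m" by (simp add: powr_realpow)
      then have "1 / 2 ^ m \<le> 1 / ?n" using n(1) by (intro divide_left_mono) auto
      also have "\<dots> = \<kappa> * log 2 ?n" using l by (simp add: \<kappa>_def)
      also have "\<dots> \<le> \<kappa> * m" using m \<kappa> by (intro mult_left_mono) auto
      finally show ?thesis .
    qed
    show "target (depth P) accepting {}"
      unfolding target_def using sinks_subset sinks_iff
      by (auto simp: accepting_def clauses_def chained_def)
    have "\<kappa> * depth P \<le> \<kappa> * nvars P" using depth_le_nvars \<kappa> by (intro mult_left_mono) auto
    also have "\<dots> = 1 / log 2 ?n" using n(1) by (simp add: \<kappa>_def)
    finally have "e + \<kappa> * depth P \<le> \<epsilon>" using n(2) by linarith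
    then show "e + \<kappa> * depth P \<le> sum (mass (depth P)) accepting * weight {}"
      using \<epsilon> by (simp add: accept_mass weight_def)
  qed
qed (use e(1) in auto)

end

lemma robp_narrow:
  assumes "P \<in> robp 3" shows "narrow_bp P"
proof -
  have P: "branching_program P" "read_once P" "width P = 3" using assms by (auto simp: robp_def)
  interpret branching_program P by (rule P(1))
  have "card {v \<in> nodes P. level P v = k} \<le> 3" for k
  proof (cases "k \<le> depth P")
    case True
    then show ?thesis using P(3) unfolding width_def
      by (metis (no_types, lifting) Max_ge atMost_iff finite_atMost finite_imageI imageI)
  next
    case False
    then have "{v \<in> nodes P. level P v = k} = {}" using level_le by blast
    then show ?thesis by (metis card.empty zero_le)
  qed
  then show ?thesis using P by (intro narrow_bp.intro read_once_bp.intro) (simp_all add: read_once_bp_axioms_def narrow_bp_axioms_def)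
qed

theorem theorem1:
  fixes \<epsilon> \<epsilon>' :: real and A :: "bool list set"
  assumes "\<epsilon> > 5 / 6"
    and "\<epsilon>' < \<epsilon>"
    and "rich (\<epsilon>' ^ 11) A"
  shows "hitting_set \<epsilon> (robp 3 :: 'v bprog set) (Omega_set 3 A)"
proof -
  \<comment> \<open>The midpoint stays above both 5/6 and \<epsilon>', and its distance to
    \<epsilon> absorbs the loss \<open>1 / log 2 n\<close> for large \<open>n\<close>.\<close>
  define e where "e = (max (5 / 6) \<epsilon>' + \<epsilon>) / 2"
  have e: "5 / 6 < e" "\<epsilon>' < e" "e < \<epsilon>" using assms(1,2) by (auto simp: e_def)
  \<comment> \<open>As 11 is odd, the positivity contained in \<open>rich\<close> makes \<epsilon>'
    nonnegative, so that its power is monotone.\<close>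
  have "0 < \<epsilon>' ^ 11" using assms(3) by (simp add: rich_def)
  then have "0 \<le> \<epsilon>'" by (simp add: zero_less_power_eq)
  then have \<eta>: "\<epsilon>' ^ 11 \<le> e ^ 11" using e(2) by (intro power_mono) auto
  define M where "M = nat \<lceil>2 powr (1 / (\<epsilon> - e))\<rceil>"
  have "1 / log 2 n \<le> \<epsilon> - e" if "M \<le> n" for n
  proof -
    have "2 powr (1 / (\<epsilon> - e)) \<le> n" using that by (simp add: M_def)
    moreover from this have "0 < real n" by (rule less_le_trans[rotated]) simp
    ultimately have "1 / (\<epsilon> - e) \<le> log 2 n" by (simp add: le_log_iff)
    moreover have "0 < 1 / (\<epsilon> - e)" using e(3) by simp
    ultimately have "1 / log 2 n \<le> 1 / (1 / (\<epsilon> - e))" by (intro divide_left_mono mult_pos_pos) linarith+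
    then show ?thesis by simp
  qed
  then have "\<forall>\<^sub>F n in sequentially. 1 / log 2 (real n) \<le> \<epsilon> - e"
    by (auto simp: eventually_sequentially)
  moreover have "\<forall>\<^sub>F n in sequentially. (2::nat) \<le> n" by (rule eventually_ge_at_top)
  moreover note assms(3)[unfolded rich_def, THEN conjunct2]
  ultimately show ?thesis
    unfolding hitting_set_def
  proof eventually_elim
    case (elim n)
    show ?case
    proof (intro ballI impI)
      fix P :: "'v bprog"
      assume P: "P \<in> robp 3" "nvars P = n" "\<epsilon> \<le> card {a \<in> cube n. eval_bp P a} / 2 ^ n"
      interpret narrow_bp P by (rule robp_narrow[OF P(1)])
      have "\<exists>a \<in> Omega_set 3 A \<inter> cube (nvars P). eval_bp P a"
      proof (rule hit_if_rich)
        show "\<epsilon> \<le> card {a \<in> cube (nvars P). eval_bp P a} / 2 ^ nvars P" using P(2,3) by simp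
        show "e + 1 / log 2 (nvars P) \<le> \<epsilon>" using elim(1) P(2) by simp
        show "2 \<le> nvars P" using elim(2) P(2) by simp
        show "\<exists>a \<in> A \<inter> cube (nvars P). (\<forall>i\<in>Q. a ! i = c ! i) \<and> (\<forall>R\<in>\<R>. \<exists>i\<in>R. a ! i \<noteq> c ! i)"
          if "c \<in> cube (nvars P)" "I \<subseteq> {..<nvars P}" "partition_on I \<R>"
            "\<epsilon>' ^ 11 \<le> (\<Prod>R\<in>\<R>. 1 - 1 / 2 ^ card R)" "Q \<subseteq> {..<nvars P} - I" "card Q \<le> log 2 (nvars P)"
          for I \<R> Q c
          using elim(3)[rule_format, OF that[unfolded P(2)]] unfolding P(2) .
      qed (use e(1) \<eta> in auto)
      then show "\<exists>a \<in> Omega_set 3 A \<inter> cube n. eval_bp P a" by (simp only: P(2))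
    qed
  qed
qed

end
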